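(* For each dimension $d$ let $R_d$ be a real random variable with $R_d>0$ almost surely, $\rho_d=\mathbb E R_d$, $\epsilon_d=\operatorname{sd}(R_d)>0$, $\xi_d=(R_d-\rho_d)/\epsilon_d$, $\tau_d=\epsilon_d/\rho_d$, $\lambda_d=\sqrt d\,\tau_d$, and let $U_d\sim\operatorname{Unif}(S^{d-1})$ be independent of $R_d$. Assume that, as $d\to\infty$, $\tau_d\to0$ and $\xi_d\Rightarrow\Xi$ in distribution for some random variable $\Xi$. Let $(R_{0,d},U_{0,d})$ (query) and $(R_{i,d},U_{i,d})$, $i=1,2,3$ (prototypes) be independent copies of $(R_d,U_d)$, let $X_{i,d}=R_{i,d}U_{i,d}\in\mathbb R^d$ and $\xi_{i,d}=(R_{i,d}-\rho_d)/\epsilon_d$ for $i=0,1,2,3$. Then the farthest-distance ordering, i.e. the ordering of the Euclidean distances $\|X_{0,d}-X_{i,d}\|$, $i=1,2,3$, is the ordering of scores $$S_{i,d}=\lambda_d\xi_{i,d}-Z_{i,d}+r_{i,d},\qquad Z_{i,d}=\sqrt d\,\langle U_{0,d},U_{i,d}\rangle,\qquad i=1,2,3,$$ for random remainders $r_{i,d}$ with the following properties. Conditionally on the prototypes, $(Z_{1,d},Z_{2,d},Z_{3,d})\Rightarrow N(0,I_3)$ in probability. Moreover, $$\max_{1\le i\le3}|r_{i,d}|\xrightarrow{p}0\quad\text{when }\lambda_d=O(1),$$ whereas $$\frac1{\lambda_d}\max_{1\le i\le3}|r_{i,d}|\xrightarrow{p}0\quad\text{when }\lambda_d\to\infty .$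$
   Context: "The ordering of the distances is the ordering of the scores" means that $\|X_{0,d}-X_{i,d}\|\le\|X_{0,d}-X_{j,d}\|$ if and only if $S_{i,d}\le S_{j,d}$, for all $i,j\in\{1,2,3\}$ (almost surely). "Conditionally on the prototypes, $\ldots\Rightarrow N(0,I_3)$ in probability" means that the conditional law of $(Z_{1,d},Z_{2,d},Z_{3,d})$ given the prototypes converges weakly to $N(0,I_3)$ in probability, i.e. for every bounded continuous $f:\mathbb R^3\to\mathbb R$ the conditional expectation of $f(Z_{1,d},Z_{2,d},Z_{3,d})$ given the prototypes converges in probability to $\mathbb E f(Z)$ with $Z\sim N(0,I_3)$. $\xrightarrow{p}$ denotes convergence in probability as $d\to\infty$. *)

theory Defs
  imports "HOL-Probability.Probability"
begin

text \<open>
  Since the dimension varies within the statement, vectors in \<open>\<real>\<^sup>d\<close> are extensional functions on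
  \<open>{..<d}\<close>; their Euclidean norm is \<^term>\<open>L2_set x {..<d}\<close>.
\<close>

abbreviation borel_vec :: "nat \<Rightarrow> (nat \<Rightarrow> real) measure" where
  "borel_vec d \<equiv> (\<Pi>\<^sub>M k\<in>{..<d}. borel)"

abbreviation inner_vec :: "nat \<Rightarrow> (nat \<Rightarrow> real) \<Rightarrow> (nat \<Rightarrow> real) \<Rightarrow> real" where
  "inner_vec d x y \<equiv> (\<Sum>k<d. x k * y k)"

abbreviation dist_vec :: "nat \<Rightarrow> (nat \<Rightarrow> real) \<Rightarrow> (nat \<Rightarrow> real) \<Rightarrow> real" where
  "dist_vec d x y \<equiv> L2_set (\<lambda>k. x k - y k) {..<d}"

text \<open>
  The uniform distribution on the unit sphere of \<open>\<real>\<^sup>d\<close>, \<open>d \<ge> 1\<close>, is the normalised surface measure.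
  In polar coordinates the surface measure of a Borel set \<open>A\<close> of unit vectors is \<open>d\<close> times the volume
  of the cone \<open>{t a | 0 < t \<le> 1, a \<in> A}\<close>, and the total mass is \<open>d\<close> times the volume of the unit ball.
  So the normalised surface measure is the image of the uniform distribution on the punctured unit
  ball under \<open>x \<mapsto> x / \<parallel>x\<parallel>\<close>.
\<close>

definition punctured_ball :: "nat \<Rightarrow> (nat \<Rightarrow> real) set" where
  "punctured_ball d = {x \<in> {..<d} \<rightarrow>\<^sub>E UNIV. 0 < L2_set x {..<d} \<and> L2_set x {..<d} \<le> 1}"

definition unif_sphere :: "nat \<Rightarrow> (nat \<Rightarrow> real) measure" where
  "unif_sphere d =
     distr (uniform_measure (\<Pi>\<^sub>M k\<in>{..<d}. lborel) (punctured_ball d)) (borel_vec d)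
       (\<lambda>x. \<lambda>k\<in>{..<d}. x k / L2_set x {..<d})"

lemma sets_lborel_vec: "sets (\<Pi>\<^sub>M k\<in>{..<d}. lborel :: real measure) = sets (borel_vec d)"
  by (rule sets_PiM_cong) auto

lemma L2_set_measurable_vec [measurable]: "(\<lambda>x. L2_set x {..<d}) \<in> borel_measurable (borel_vec d)"
  unfolding L2_set_def by measurable

lemma punctured_ball_sets [measurable]:
  "punctured_ball d \<in> sets (\<Pi>\<^sub>M k\<in>{..<d}. lborel)"
proof -
  have "punctured_ball d =
      {x \<in> space (borel_vec d). 0 < L2_set x {..<d} \<and> L2_set x {..<d} \<le> 1}"
    by (simp add: punctured_ball_def space_PiM)
  also have "\<dots> \<in> sets (borel_vec d)"
    by measurable
  finally show ?thesis
    by (simp add: sets_lborel_vec)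
qed

lemma punctured_ball_volume:
  assumes "d \<ge> 1"
  shows "0 < emeasure (\<Pi>\<^sub>M k\<in>{..<d}. lborel) (punctured_ball d)"
    and "emeasure (\<Pi>\<^sub>M k\<in>{..<d}. lborel) (punctured_ball d) < \<infinity>"
proof -
  interpret product_sigma_finite "\<lambda>_::nat. lborel :: real measure"
    by standard
  let ?L = "\<Pi>\<^sub>M k\<in>{..<d}. lborel :: real measure"
  let ?A = "\<Pi>\<^sub>E k\<in>{..<d}. {0<..1 / real d}"
  let ?B = "\<Pi>\<^sub>E k\<in>{..<d}. {-1..1 :: real}"
  have "?A \<subseteq> punctured_ball d"
  proof
    fix x assume x: "x \<in> ?A"
    then have pos: "0 < x k" and le: "x k \<le> 1 / real d" if "k < d" for k
      using that by (auto simp: PiE_def Pi_def)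
    have "L2_set x {..<d} \<le> (\<Sum>k<d. x k)"
      by (rule L2_set_le_sum) (use pos in \<open>auto intro: less_imp_le\<close>)
    also have "\<dots> \<le> (\<Sum>k<d. 1 / real d)"
      by (rule sum_mono) (use le in auto)
    finally have "L2_set x {..<d} \<le> 1"
      using assms by simp
    moreover have "0 < x 0" and "x 0 \<le> L2_set x {..<d}"
      using pos[of 0] member_le_L2_set[of "{..<d}" 0 x] assms by auto
    ultimately show "x \<in> punctured_ball d"
      using x by (auto simp: punctured_ball_def PiE_def)
  qed
  then have "emeasure ?L ?A \<le> emeasure ?L (punctured_ball d)"
    by (rule emeasure_mono) simp
  moreover have "emeasure ?L ?A = (\<Prod>k<d. emeasure lborel {0<..1 / real d})"
    by (rule emeasure_PiM) auto
  moreover have "\<dots> = (\<Prod>k<d. ennreal (1 / real d))"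
    by (rule prod.cong) auto
  moreover have "\<dots> > 0"
    using assms by (simp add: zero_less_iff_neq_zero ennreal_eq_0_iff)
  ultimately show "0 < emeasure ?L (punctured_ball d)"
    by (metis less_le_trans)
  have "punctured_ball d \<subseteq> ?B"
  proof
    fix x assume x: "x \<in> punctured_ball d"
    have "\<bar>x k\<bar> \<le> 1" if "k < d" for k
    proof -
      have "\<bar>x k\<bar> \<le> L2_set (\<lambda>k. \<bar>x k\<bar>) {..<d}"
        by (rule member_le_L2_set) (use that in auto)
      also have "\<dots> = L2_set x {..<d}"
        by (simp add: L2_set_def)
      finally show ?thesis
        using x by (simp add: punctured_ball_def)
    qed
    then show "x \<in> ?B"
      using x by (auto simp: punctured_ball_def PiE_def abs_le_iff)
  qed
  then have "emeasure ?L (punctured_ball d) \<le> emeasure ?L ?B"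
    by (rule emeasure_mono) (auto intro!: sets_PiM_I_finite)
  also have "\<dots> = (\<Prod>k<d. emeasure lborel {-1..1 :: real})"
    by (rule emeasure_PiM) auto
  also have "\<dots> < \<infinity>"
    by (simp add: ennreal_prod_eq_top less_top[symmetric] power_eq_top_ennreal)
  finally show "emeasure ?L (punctured_ball d) < \<infinity>" .
qed

lemma normalise_measurable [measurable]:
  "(\<lambda>x. \<lambda>k\<in>{..<d}. x k / L2_set x {..<d}) \<in> measurable (borel_vec d) (borel_vec d)"
  by measurable

lemma normalise_measurable_ball [measurable]:
  "(\<lambda>x. \<lambda>k\<in>{..<d}. x k / L2_set x {..<d})
     \<in> measurable (uniform_measure (\<Pi>\<^sub>M k\<in>{..<d}. lborel) (punctured_ball d)) (borel_vec d)"
  using normalise_measurable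
  by (subst measurable_cong_sets[OF _ refl, where M' = "borel_vec d"])
    (simp_all only: sets_uniform_measure sets_lborel_vec)

lemma prob_space_unif_sphere:
  assumes "d \<ge> 1"
  shows "prob_space (unif_sphere d)"
proof -
  have "prob_space (uniform_measure (\<Pi>\<^sub>M k\<in>{..<d}. lborel :: real measure) (punctured_ball d))"
    using punctured_ball_volume[OF assms] by (intro prob_space_uniform_measure) auto
  then show ?thesis
    unfolding unif_sphere_def by (rule prob_space.prob_space_distr) measurable
qed

lemma unif_sphere_unit_norm:
  assumes "d \<ge> 1"
  shows "AE x in unif_sphere d. L2_set x {..<d} = 1"
proof -
  have eq: "L2_set (\<lambda>k\<in>{..<d}. x k / L2_set x {..<d}) {..<d} = 1"
    if "x \<in> punctured_ball d" for x
  proof -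
    have pos: "0 < L2_set x {..<d}"
      using that by (simp add: punctured_ball_def)
    have "L2_set (\<lambda>k\<in>{..<d}. x k / L2_set x {..<d}) {..<d}
        = L2_set (\<lambda>k. (1 / L2_set x {..<d}) * x k) {..<d}"
      by (rule L2_set_cong) auto
    also have "\<dots> = (1 / L2_set x {..<d}) * L2_set x {..<d}"
      by (rule L2_set_right_distrib[symmetric]) simp
    finally show ?thesis
      using pos by simp
  qed
  have "AE x in uniform_measure (\<Pi>\<^sub>M k\<in>{..<d}. lborel) (punctured_ball d). x \<in> punctured_ball d"
    by (rule AE_uniform_measureI) auto
  then show ?thesis
    unfolding unif_sphere_def by (subst AE_distr_iff) (auto elim!: eventually_mono simp: eq)
qed

definition std_normal_vec :: "(real ^ 'n) measure" where
  "std_normal_vec = density lborel (\<lambda>x. ennreal (\<Prod>i\<in>UNIV. std_normal_density (x $ i)))"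

abbreviation stddev :: "'a measure \<Rightarrow> ('a \<Rightarrow> real) \<Rightarrow> real" where
  "stddev M X \<equiv> sqrt (prob_space.variance M X)"

definition conv_in_prob :: "(nat \<Rightarrow> 'a measure) \<Rightarrow> (nat \<Rightarrow> 'a \<Rightarrow> real) \<Rightarrow> real \<Rightarrow> bool" where
  "conv_in_prob M X c \<longleftrightarrow>
     (\<forall>\<delta>>0. (\<lambda>d. measure (M d) {\<omega> \<in> space (M d). \<bar>X d \<omega> - c\<bar> > \<delta>}) \<longlonglongrightarrow> 0)"

definition cond_weak_conv_in_prob ::
  "(nat \<Rightarrow> 'a measure) \<Rightarrow> (nat \<Rightarrow> 'a measure) \<Rightarrow> (nat \<Rightarrow> 'a \<Rightarrow> 'b::real_normed_vector)
    \<Rightarrow> 'b measure \<Rightarrow> bool" where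
  "cond_weak_conv_in_prob M F Y L \<longleftrightarrow>
     (\<forall>f :: 'b \<Rightarrow> real. continuous_on UNIV f \<longrightarrow> bounded (range f) \<longrightarrow>
        conv_in_prob M (\<lambda>d. real_cond_exp (M d) (F d) (\<lambda>\<omega>. f (Y d \<omega>))) (\<integral>x. f x \<partial>L))"

text \<open>The \<open>\<sigma>\<close>-algebra on \<open>M\<close> generated by the random variables \<open>Y i\<close>, \<open>i \<in> I\<close>, with values in \<open>E\<close>.\<close>

definition generated_by :: "'a measure \<Rightarrow> 'b measure \<Rightarrow> ('i \<Rightarrow> 'a \<Rightarrow> 'b) \<Rightarrow> 'i set \<Rightarrow> 'a measure" where
  "generated_by M E Y I = vimage_algebra (space M) (\<lambda>\<omega>. \<lambda>i\<in>I. Y i \<omega>) (\<Pi>\<^sub>M i\<in>I. E)"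

end

theory Submission
  imports Defs
begin

text \<open>
  The squared distance to a prototype is
  \<open>\<parallel>X\<^sub>0 - X\<^sub>i\<parallel>\<^sup>2 = R\<^sub>0\<^sup>2 + R\<^sub>i\<^sup>2 - 2 R\<^sub>0 R\<^sub>i \<langle>U\<^sub>0, U\<^sub>i\<rangle>\<close>. Subtracting \<open>R\<^sub>0\<^sup>2 + \<rho>\<^sup>2\<close>, which is common to
  all prototypes, and multiplying by \<open>\<surd>d / (2 \<rho>\<^sup>2) > 0\<close> preserves the ordering. After the
  substitution \<open>R\<^sub>i = \<rho> (1 + \<tau> \<xi>\<^sub>i)\<close> the result is exactly \<open>\<lambda> \<xi>\<^sub>i - Z\<^sub>i + r\<^sub>i\<close> with
  \<open>r\<^sub>i = \<lambda> \<tau> \<xi>\<^sub>i\<^sup>2 / 2 - (\<tau> \<xi>\<^sub>0 + \<tau> \<xi>\<^sub>i + \<tau>\<^sup>2 \<xi>\<^sub>0 \<xi>\<^sub>i) Z\<^sub>i\<close> (lemma \<open>score_identity\<close>). The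
  variables \<open>\<xi>\<close> have variance 1 and are tight by Chebyshev's inequality, and the \<open>Z\<^sub>i\<close> are tight as well
  (lemma \<open>indep_sphere_inner_tail\<close>). Each term of \<open>r\<^sub>i\<close> has a factor \<open>\<tau> \<rightarrow> 0\<close>, so \<open>r\<^sub>i\<close> tends to 0 in
  probability for bounded \<open>\<lambda>\<close> and is \<open>o(\<lambda>)\<close> for divergent \<open>\<lambda>\<close>.

  The conditional limit law rests on the Gaussian representation of the sphere: a standard Gaussian
  vector divided by its norm is uniform (proposition \<open>unif_sphere_eq_gauss_direction\<close>). Since the
  squared norm concentrates around \<open>d\<close>, a projection \<open>\<surd>d \<langle>V, w\<rangle>\<close> of a uniform direction \<open>V\<close> differs little
  from a Gaussian linear form, and its characteristic function is within \<open>O(1/\<surd>d)\<close> of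
  \<open>exp (- \<parallel>w\<parallel>\<^sup>2 / 2)\<close> (lemma \<open>unif_sphere_char\<close>). Applied to linear combinations of several fixed vectors,
  this yields the joint characteristic function of the projections on them, which is asymptotically that
  of a standard normal vector as soon as the Gram matrix tends to the identity. A continuity theorem for
  characteristic functions in \<open>real ^ 'n\<close>, proved by Gaussian smoothing (proposition
  \<open>bounded_continuous_tendsto\<close>), turns this into weak convergence, uniformly over all families of vectors
  with Gram matrix close to the identity (proposition \<open>projections_clt_uniform\<close>).

  Given the prototypes, the direction of the query is still uniform, so the conditional expectation
  of \<open>f (Z\<^sub>1, Z\<^sub>2, Z\<^sub>3)\<close> is the integral of \<open>f\<close> over the projections of a uniform direction on
  \<open>U\<^sub>1\<close>, \<open>U\<^sub>2\<close>, \<open>U\<^sub>3\<close> (lemma \<open>real_cond_exp_indep\<close>). The prototypes are themselves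
  independent uniform directions, hence nearly orthonormal with high probability, and the uniform limit
  theorem applies.
\<close>

section \<open>The uniform direction as a normalised Gaussian vector\<close>

abbreviation lborel_vec :: "nat \<Rightarrow> (nat \<Rightarrow> real) measure" where
  "lborel_vec d \<equiv> (\<Pi>\<^sub>M k\<in>{..<d}. lborel)"

definition gauss_vec :: "nat \<Rightarrow> (nat \<Rightarrow> real) measure" where
  "gauss_vec d = (\<Pi>\<^sub>M k\<in>{..<d}. std_normal_distribution)"

lemma sets_gauss_vec [measurable_cong]: "sets (gauss_vec d) = sets (borel_vec d)"
  unfolding gauss_vec_def by (rule sets_PiM_cong) auto

lemma sets_lborel_vec_cong [measurable_cong]: "sets (lborel_vec d) = sets (borel_vec d)"
  by (rule sets_lborel_vec)

lemma space_gauss_vec: "space (gauss_vec d) = {..<d} \<rightarrow>\<^sub>E UNIV"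
  by (simp add: gauss_vec_def space_PiM)

interpretation std_normal: prob_space std_normal_distribution
  by (rule prob_space_normal_density) simp

interpretation lborel_factors: product_sigma_finite "\<lambda>_::nat. lborel :: real measure"
  by standard

interpretation gauss_factors: product_sigma_finite "\<lambda>_::nat. std_normal_distribution"
  by standard

interpretation gauss_vec: prob_space "gauss_vec d" for d
  unfolding gauss_vec_def by (intro prob_space_PiM std_normal.prob_space_axioms)

lemma L2_set_restrict_divide:
  assumes "0 < t"
  shows "L2_set (\<lambda>k\<in>A. x k / t) A = L2_set x A / t"
proof -
  have "L2_set (\<lambda>k\<in>A. x k / t) A = L2_set (\<lambda>k. (1 / t) * x k) A"
    by (rule L2_set_cong) auto
  also have "\<dots> = (1 / t) * L2_set x A"
    using assms by (intro L2_set_right_distrib[symmetric]) simp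
  finally show ?thesis by simp
qed

text \<open>
  On boxes this is the one-dimensional scaling law, once for each coordinate, and boxes determine
  a product measure.
\<close>

lemma emeasure_lborel_vec_scale:
  fixes t :: real
  assumes t: "0 < t" and A: "A \<in> sets (borel_vec d)"
  shows "emeasure (lborel_vec d) {x \<in> space (borel_vec d). (\<lambda>k\<in>{..<d}. x k / t) \<in> A}
           = ennreal (t ^ d) * emeasure (lborel_vec d) A"
proof -
  let ?s = "\<lambda>x::nat \<Rightarrow> real. \<lambda>k\<in>{..<d}. x k / t"
  have meas: "?s \<in> measurable (lborel_vec d) (lborel_vec d)"
    by measurable
  define P where "P = scale_measure (ennreal ((1/t) ^ d)) (distr (lborel_vec d) (lborel_vec d) ?s)"
  have "P = lborel_vec d"
  proof (rule lborel_factors.PiM_eqI)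
    show "finite {..<d}" by simp
    show "sets P = sets (lborel_vec d)" by (simp add: P_def)
    fix B :: "nat \<Rightarrow> real set" assume B: "\<And>i. i \<in> {..<d} \<Longrightarrow> B i \<in> sets lborel"
    have mB: "Pi\<^sub>E {..<d} B \<in> sets (lborel_vec d)"
      using B by (intro sets_PiM_I_finite) auto
    have one: "emeasure lborel ((\<lambda>y. y / t) -` C) = ennreal t * emeasure lborel C" if "C \<in> sets borel" for C :: "real set"
    proof -
      have m: "(\<lambda>y. y / t) -` C \<in> sets borel"
        using measurable_sets[of "\<lambda>y. y / t" borel borel C] that by simp
      have "emeasure lborel ((\<lambda>y. y / t) -` C) = (\<integral>\<^sup>+y. indicator ((\<lambda>y. y / t) -` C) y \<partial>lborel)"
        using m by (simp add: )
      also have "\<dots> = \<bar>t\<bar> * (\<integral>\<^sup>+y. indicator ((\<lambda>y. y / t) -` C) (0 + t * y) \<partial>lborel)"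
        by (rule nn_integral_real_affine) (use m t in auto)
      also have "(\<integral>\<^sup>+y. indicator ((\<lambda>y. y / t) -` C) (0 + t * y) \<partial>lborel) = (\<integral>\<^sup>+y. indicator C y \<partial>lborel)"
        using t by (intro nn_integral_cong) (auto simp: indicator_def)
      finally show ?thesis using t that by simp
    qed
    have "?s -` Pi\<^sub>E {..<d} B \<inter> space (lborel_vec d) = Pi\<^sub>E {..<d} (\<lambda>i. (\<lambda>y. y / t) -` B i)"
      by (auto simp: space_PiM PiE_def extensional_def Pi_def)
    then have "emeasure P (Pi\<^sub>E {..<d} B)
        = ennreal ((1/t)^d) * emeasure (lborel_vec d) (Pi\<^sub>E {..<d} (\<lambda>i. (\<lambda>y. y / t) -` B i))"
      unfolding P_def using mB meas by (simp add: emeasure_distr)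
    also have "emeasure (lborel_vec d) (Pi\<^sub>E {..<d} (\<lambda>i. (\<lambda>y. y / t) -` B i))
        = (\<Prod>i<d. emeasure lborel ((\<lambda>y. y / t) -` B i))"
      by (rule lborel_factors.emeasure_PiM) (use B measurable_sets[of "\<lambda>y. y / t" borel borel] in auto)
    also have "\<dots> = (\<Prod>i<d. ennreal t * emeasure lborel (B i))"
      using B by (intro prod.cong) (auto simp: one)
    also have "ennreal ((1/t)^d) * \<dots> = ennreal ((1/t)^d) * ennreal t ^ d * (\<Prod>i<d. emeasure lborel (B i))"
      by (simp add: prod.distrib mult.assoc)
    also have "ennreal ((1/t)^d) * ennreal t ^ d = 1"
      using t by (simp add: ennreal_power ennreal_mult[symmetric] power_mult_distrib[symmetric] del: power_one_over)
    finally show "emeasure P (Pi\<^sub>E {..<d} B) = (\<Prod>i\<in>{..<d}. emeasure lborel (B i))" by simp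
  qed
  then have "emeasure (lborel_vec d) A = emeasure P A" by simp
  also have "\<dots> = ennreal ((1/t)^d) * emeasure (lborel_vec d) (?s -` A \<inter> space (lborel_vec d))"
    unfolding P_def using A meas by (simp add: emeasure_distr sets_lborel_vec)
  finally have "ennreal (t^d) * emeasure (lborel_vec d) A
      = (ennreal (t^d) * ennreal ((1/t)^d)) * emeasure (lborel_vec d) (?s -` A \<inter> space (lborel_vec d))"
    by (simp add: mult.assoc)
  also have "ennreal (t^d) * ennreal ((1/t)^d) = 1"
    using t by (simp add: ennreal_mult[symmetric] power_mult_distrib[symmetric] del: power_one_over)
  also have "?s -` A \<inter> space (lborel_vec d) = {x \<in> space (borel_vec d). ?s x \<in> A}"
    by (auto simp: space_PiM)
  finally show ?thesis by simp
qed

text \<open>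
  The product of the coordinate densities depends on the norm alone; this is what links the
  Gaussian to the sphere.
\<close>

lemma gauss_vec_density:
  "gauss_vec d = density (lborel_vec d)
     (\<lambda>x. ennreal ((1 / sqrt (2 * pi)) ^ d * exp (- (L2_set x {..<d})\<^sup>2 / 2)))"
proof -
  have *: "(1 / sqrt (2 * pi)) ^ d * exp (- (L2_set x {..<d})\<^sup>2 / 2) = (\<Prod>k<d. std_normal_density (x k))" for x
  proof -
    have "(\<Prod>k<d. std_normal_density (x k)) = (1 / sqrt (2 * pi)) ^ d * exp (\<Sum>k<d. - (x k)\<^sup>2 / 2)"
      unfolding std_normal_density_def prod.distrib by (simp add: exp_sum)
    also have "(\<Sum>k<d. - (x k)\<^sup>2 / 2) = - (L2_set x {..<d})\<^sup>2 / 2"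
      by (simp add: L2_set_def sum_nonneg sum_divide_distrib sum_negf)
    finally show ?thesis ..
  qed
  have "density (lborel_vec d) (\<lambda>x. ennreal (\<Prod>k<d. std_normal_density (x k))) = gauss_vec d"
    unfolding gauss_vec_def
  proof (rule gauss_factors.PiM_eqI)
    show "finite {..<d}" by simp
    show "sets (density (lborel_vec d) (\<lambda>x. ennreal (\<Prod>k<d. std_normal_density (x k)))) =
      sets (\<Pi>\<^sub>M k\<in>{..<d}. std_normal_distribution)"
      by (simp cong: sets_PiM_cong)
    fix B :: "nat \<Rightarrow> real set" assume B: "\<And>i. i \<in> {..<d} \<Longrightarrow> B i \<in> sets std_normal_distribution"
    have mB: "Pi\<^sub>E {..<d} B \<in> sets (lborel_vec d)"
      using B by (intro sets_PiM_I_finite) auto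
    have "emeasure (density (lborel_vec d) (\<lambda>x. ennreal (\<Prod>k<d. std_normal_density (x k)))) (Pi\<^sub>E {..<d} B)
       = (\<integral>\<^sup>+x. ennreal (\<Prod>k<d. std_normal_density (x k)) * indicator (Pi\<^sub>E {..<d} B) x \<partial>lborel_vec d)"
      by (intro emeasure_density mB) measurable
    also have "\<dots> = (\<integral>\<^sup>+x. (\<Prod>k<d. ennreal (std_normal_density (x k)) * indicator (B k) (x k)) \<partial>lborel_vec d)"
    proof (rule nn_integral_cong)
      fix x assume x: "x \<in> space (lborel_vec d)"
      have "(indicator (Pi\<^sub>E {..<d} B) x :: ennreal) = (\<Prod>k<d. indicator (B k) (x k))"
        using x by (auto simp: indicator_def space_PiM PiE_def Pi_def extensional_def)
      then show "ennreal (\<Prod>k<d. std_normal_density (x k)) * indicator (Pi\<^sub>E {..<d} B) x =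
          (\<Prod>k<d. ennreal (std_normal_density (x k)) * indicator (B k) (x k))"
        by (simp add: prod.distrib prod_ennreal)
    qed
    also have "\<dots> = (\<Prod>k<d. \<integral>\<^sup>+y. ennreal (std_normal_density y) * indicator (B k) y \<partial>lborel)"
    proof (rule lborel_factors.product_nn_integral_prod)
      fix k assume "k \<in> {..<d}"
      then have [measurable]: "B k \<in> sets borel" using B by simp
      show "(\<lambda>y. ennreal (std_normal_density y) * indicator (B k) y) \<in> borel_measurable lborel"
        by measurable
    qed simp
    also have "\<dots> = (\<Prod>k<d. emeasure std_normal_distribution (B k))"
      using B by (intro prod.cong) (auto simp: emeasure_density)
    finally show "emeasure (density (lborel_vec d) (\<lambda>x. ennreal (\<Prod>k<d. std_normal_density (x k)))) (Pi\<^sub>E {..<d} B)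
       = (\<Prod>k\<in>{..<d}. emeasure std_normal_distribution (B k))" .
  qed
  then show ?thesis unfolding * ..
qed

text \<open>
  The Gaussian radial profile is thereby a mixture of indicators of balls \<open>r \<le> t\<close>.
\<close>

lemma exp_layer_cake:
  fixes r :: real
  assumes "0 \<le> r"
  shows "ennreal (exp (- r\<^sup>2 / 2)) = (\<integral>\<^sup>+t. ennreal (t * exp (- t\<^sup>2 / 2)) * indicator {r..} t \<partial>lborel)"
proof -
  have "(\<integral>\<^sup>+t. ennreal (t * exp (- t\<^sup>2 / 2)) * indicator {r..} t \<partial>lborel) = ennreal (0 - (- exp (- r\<^sup>2 / 2)))"
  proof (rule nn_integral_FTC_atLeast)
    show "((\<lambda>t::real. - exp (- t\<^sup>2 / 2)) has_real_derivative t * exp (- t\<^sup>2 / 2)) (at t)" for t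
      by (auto intro!: derivative_eq_intros)
    have "filterlim (\<lambda>t::real. (- 1 / 2) * t\<^sup>2) at_bot at_top"
      by (rule filterlim_tendsto_neg_mult_at_bot[OF tendsto_const])
        (auto intro: filterlim_pow_at_top filterlim_ident)
    then have "filterlim (\<lambda>t::real. - t\<^sup>2 / 2) at_bot at_top" by simp
    then have "((\<lambda>t::real. - exp (- t\<^sup>2 / 2)) \<longlongrightarrow> - 0) at_top"
      by (intro tendsto_minus filterlim_compose[OF exp_at_bot])
    then show "((\<lambda>t::real. - exp (- t\<^sup>2 / 2)) \<longlongrightarrow> 0) at_top" by simp
  qed (use assms in auto)
  then show ?thesis by simp
qed

text \<open>
  By the layer-cake formula, the Gaussian measure of \<open>C\<close> is a mixture over \<open>t\<close> of the volumes of
  \<open>C \<inter> {\<parallel>x\<parallel> \<le> t}\<close>. If \<open>C\<close> is a cone, that volume is \<open>t ^ d\<close> times its value at \<open>t = 1\<close>, so the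
  integral over \<open>t\<close> splits off as a constant \<open>\<kappa>\<close> that is the same for every cone. Its
  value will follow from the total mass being 1.
\<close>

lemma gauss_vec_cone:
  "\<exists>\<kappa>::ennreal. \<forall>C\<in>sets (borel_vec d).
     (\<forall>x\<in>space (borel_vec d). \<forall>t>0. (\<lambda>k\<in>{..<d}. x k / t) \<in> C \<longleftrightarrow> x \<in> C) \<longrightarrow>
     emeasure (gauss_vec d) C = \<kappa> * emeasure (lborel_vec d) {x \<in> C. L2_set x {..<d} \<le> 1}"
proof (intro exI ballI impI)
  define c :: real where "c = (1 / sqrt (2 * pi)) ^ d"
  have c0: "0 \<le> c" by (simp add: c_def)
  interpret L: sigma_finite_measure "lborel_vec d"
    by (rule lborel_factors.sigma_finite) simp
  interpret pair_sigma_finite "lborel_vec d" "lborel :: real measure" ..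
  fix C :: "(nat \<Rightarrow> real) set"
  assume C[measurable]: "C \<in> sets (borel_vec d)"
  assume cone: "\<forall>x\<in>space (borel_vec d). \<forall>t>0. (\<lambda>k\<in>{..<d}. x k / t) \<in> C \<longleftrightarrow> x \<in> C"
  have sub: "C \<subseteq> space (borel_vec d)" using C by (rule sets.sets_into_space)
  let ?r = "\<lambda>x::nat\<Rightarrow>real. L2_set x {..<d}"
  let ?g = "\<lambda>t::real. ennreal (t * exp (- t\<^sup>2 / 2)) * indicator {0<..} t"
  let ?B = "\<lambda>t. {x \<in> C. ?r x \<le> t}"
  have mB[measurable]: "?B t \<in> sets (borel_vec d)" for t
  proof -
    have "?B t = {x \<in> space (borel_vec d). x \<in> C \<and> ?r x \<le> t}" using sub by auto
    also have "\<dots> \<in> sets (borel_vec d)" by measurable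
    finally show ?thesis .
  qed
  have volB: "emeasure (lborel_vec d) (?B t) = ennreal (t ^ d) * emeasure (lborel_vec d) (?B 1)" if t: "0 < t" for t
  proof -
    have "?B t = {x \<in> space (borel_vec d). (\<lambda>k\<in>{..<d}. x k / t) \<in> ?B 1}"
    proof (rule set_eqI)
      fix x
      show "x \<in> ?B t \<longleftrightarrow> x \<in> {x \<in> space (borel_vec d). (\<lambda>k\<in>{..<d}. x k / t) \<in> ?B 1}"
        unfolding mem_Collect_eq L2_set_restrict_divide[OF t] using sub t cone by auto
    qed
    then show ?thesis using emeasure_lborel_vec_scale[OF t mB[of 1]] by simp
  qed
  have "emeasure (gauss_vec d) C
      = (\<integral>\<^sup>+x. ennreal (c * exp (- (?r x)\<^sup>2 / 2)) * indicator C x \<partial>lborel_vec d)"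
    unfolding gauss_vec_density c_def by (rule emeasure_density) measurable
  also have "\<dots> = (\<integral>\<^sup>+x. c * (\<integral>\<^sup>+t. ?g t * indicator (?B t) x \<partial>lborel) \<partial>lborel_vec d)"
  proof (rule nn_integral_cong)
    fix x
    have "ennreal (c * exp (- (?r x)\<^sup>2 / 2)) * indicator C x
        = c * ((\<integral>\<^sup>+t. ennreal (t * exp (- t\<^sup>2 / 2)) * indicator {?r x..} t \<partial>lborel) * indicator C x)"
      using exp_layer_cake[of "?r x"] c0 by (simp add: ennreal_mult mult.assoc)
    also have "(\<integral>\<^sup>+t. ennreal (t * exp (- t\<^sup>2 / 2)) * indicator {?r x..} t \<partial>lborel) * indicator C x
        = (\<integral>\<^sup>+t. ennreal (t * exp (- t\<^sup>2 / 2)) * indicator {?r x..} t * indicator C x \<partial>lborel)"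
      by (rule nn_integral_multc[symmetric]) measurable
    also have "\<dots> = (\<integral>\<^sup>+t. ?g t * indicator (?B t) x \<partial>lborel)"
      by (intro nn_integral_cong)
        (auto simp: indicator_def ennreal_eq_0_iff not_less split: if_splits intro: mult_nonpos_nonneg order_trans[OF L2_set_nonneg])
    finally show "ennreal (c * exp (- (?r x)\<^sup>2 / 2)) * indicator C x
        = c * (\<integral>\<^sup>+t. ?g t * indicator (?B t) x \<partial>lborel)" .
  qed
  also have "\<dots> = c * (\<integral>\<^sup>+x. (\<integral>\<^sup>+t. ?g t * indicator (?B t) x \<partial>lborel) \<partial>lborel_vec d)"
  proof (rule nn_integral_cmult)
    have "(\<lambda>x. \<integral>\<^sup>+t. (if x \<in> C \<and> ?r x \<le> t then ?g t else 0) \<partial>lborel) \<in> borel_measurable (lborel_vec d)"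
      by measurable
    also have "(\<lambda>x. \<integral>\<^sup>+t. (if x \<in> C \<and> ?r x \<le> t then ?g t else 0) \<partial>lborel) = (\<lambda>x. \<integral>\<^sup>+t. ?g t * indicator (?B t) x \<partial>lborel)"
      by (intro ext nn_integral_cong) (auto simp: indicator_def)
    finally show "\<dots> \<in> borel_measurable (lborel_vec d)" .
  qed
  also have "(\<integral>\<^sup>+x. (\<integral>\<^sup>+t. ?g t * indicator (?B t) x \<partial>lborel) \<partial>lborel_vec d)
     = (\<integral>\<^sup>+t. (\<integral>\<^sup>+x. ?g t * indicator (?B t) x \<partial>lborel_vec d) \<partial>lborel)"
  proof (rule Fubini'[symmetric])
    have "(\<lambda>z. if fst z \<in> C \<and> ?r (fst z) \<le> snd z then ?g (snd z) else 0) \<in> borel_measurable (lborel_vec d \<Otimes>\<^sub>M lborel)"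
      by measurable
    also have "(\<lambda>z. if fst z \<in> C \<and> ?r (fst z) \<le> snd z then ?g (snd z) else 0) = (\<lambda>(x,t). ?g t * indicator (?B t) x)"
      by (intro ext) (auto simp: indicator_def)
    finally show "\<dots> \<in> borel_measurable (lborel_vec d \<Otimes>\<^sub>M lborel)" .
  qed
  also have "\<dots> = (\<integral>\<^sup>+t. (?g t * ennreal (t ^ d)) * emeasure (lborel_vec d) (?B 1) \<partial>lborel)"
  proof (rule nn_integral_cong)
    fix t :: real
    have "(\<integral>\<^sup>+x. ?g t * indicator (?B t) x \<partial>lborel_vec d) = ?g t * emeasure (lborel_vec d) (?B t)"
      using mB[of t] by (subst nn_integral_cmult) (auto simp: sets_lborel_vec)
    then show "(\<integral>\<^sup>+x. ?g t * indicator (?B t) x \<partial>lborel_vec d) = (?g t * ennreal (t ^ d)) * emeasure (lborel_vec d) (?B 1)"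
      by (cases "0 < t") (simp_all add: volB[of t] mult.assoc)
  qed
  also have "\<dots> = (\<integral>\<^sup>+t. ?g t * ennreal (t ^ d) \<partial>lborel) * emeasure (lborel_vec d) (?B 1)"
    by (rule nn_integral_multc) measurable
  finally show "emeasure (gauss_vec d) C = (ennreal ((1 / sqrt (2 * pi)) ^ d) * (\<integral>\<^sup>+t. ?g t * ennreal (t ^ d) \<partial>lborel))
     * emeasure (lborel_vec d) (?B 1)"
    by (simp add: mult.assoc c_def)
qed

text \<open>
  The set of vectors whose direction lies in a given set is a cone, so Gaussian measure and volume
  in the unit ball agree on it up to a factor; both are probability measures after normalisation.
\<close>

proposition unif_sphere_eq_gauss_direction:
  assumes d: "d \<ge> 1"
  shows "unif_sphere d = distr (gauss_vec d) (borel_vec d) (\<lambda>x. \<lambda>k\<in>{..<d}. x k / L2_set x {..<d})"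
proof -
  let ?n = "\<lambda>x. \<lambda>k\<in>{..<d}. x k / L2_set x {..<d}"
  let ?r = "\<lambda>x::nat\<Rightarrow>real. L2_set x {..<d}"
  let ?L = "lborel_vec d" and ?pb = "punctured_ball d"
  obtain \<kappa> :: ennreal where \<kappa>: "\<forall>C\<in>sets (borel_vec d).
      (\<forall>x\<in>space (borel_vec d). \<forall>t>0. (\<lambda>k\<in>{..<d}. x k / t) \<in> C \<longleftrightarrow> x \<in> C) \<longrightarrow>
      emeasure (gauss_vec d) C = \<kappa> * emeasure ?L {x \<in> C. ?r x \<le> 1}"
    using gauss_vec_cone[of d] by (rule exE)
  define C where "C A = {x \<in> space (borel_vec d). ?r x \<noteq> 0 \<and> ?n x \<in> A}" for A
  have mC[measurable]: "C A \<in> sets (borel_vec d)" if "A \<in> sets (borel_vec d)" for A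
    unfolding C_def using that by measurable
  have C_cone: "(\<lambda>k\<in>{..<d}. x k / t) \<in> C A \<longleftrightarrow> x \<in> C A"
    if "x \<in> space (borel_vec d)" "0 < t" for x t A
  proof -
    have "?n (\<lambda>k\<in>{..<d}. x k / t) = ?n x"
      unfolding L2_set_restrict_divide[OF that(2)] using that(2) by (intro restrict_ext) simp
    moreover have "(\<lambda>k\<in>{..<d}. x k / t) \<in> space (borel_vec d)" by (simp add: space_PiM)
    ultimately show ?thesis
      unfolding C_def mem_Collect_eq L2_set_restrict_divide[OF that(2)] using that by simp
  qed
  have C_ball: "{x \<in> C A. ?r x \<le> 1} = {x \<in> ?pb. ?n x \<in> A}" for A
  proof -
    have "?r x \<noteq> 0 \<longleftrightarrow> 0 < ?r x" for x
      using L2_set_nonneg[of x "{..<d}"] by linarith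
    then show ?thesis unfolding C_def punctured_ball_def by (auto simp: space_PiM)
  qed
  have gC: "emeasure (gauss_vec d) (C A) = \<kappa> * emeasure ?L {x \<in> ?pb. ?n x \<in> A}" if "A \<in> sets (borel_vec d)" for A
    using bspec[OF \<kappa> mC[OF that]] C_cone C_ball by simp
  \<comment> \<open>The origin has no direction, and normalising it yields 0; it must be discarded, and for
      \<open>d \<ge> 1\<close> it is a null set.\<close>
  have null: "emeasure (gauss_vec d) {x \<in> space (borel_vec d). ?r x = 0} = 0"
  proof -
    have "{x \<in> space (borel_vec d). ?r x = 0} = Pi\<^sub>E {..<d} (\<lambda>_. {0})"
      by (auto simp: space_PiM PiE_def Pi_def extensional_def L2_set_eq_0_iff)
    also have "emeasure (gauss_vec d) \<dots> = (\<Prod>k<d. emeasure std_normal_distribution {0})"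
      unfolding gauss_vec_def by (rule gauss_factors.emeasure_PiM) auto
    also have "\<dots> = 0"
    proof -
      have "emeasure std_normal_distribution {0} = 0"
        by (subst emeasure_density) (auto simp: nn_integral_0_iff_AE intro!: AE_I[of _ _ "{0}"])
      then show ?thesis using d by (simp add: power_0_left)
    qed
    finally show ?thesis .
  qed
  have split: "emeasure (gauss_vec d) {x \<in> space (borel_vec d). ?n x \<in> A} = emeasure (gauss_vec d) (C A)"
    if A[measurable]: "A \<in> sets (borel_vec d)" for A
  proof (rule emeasure_eq_AE)
    have "AE x in gauss_vec d. ?r x \<noteq> 0"
      using null by (intro AE_I[of _ _ "{x \<in> space (borel_vec d). ?r x = 0}"])
        (auto simp: space_gauss_vec space_PiM sets_gauss_vec)
    then show "AE x in gauss_vec d. x \<in> {x \<in> space (borel_vec d). ?n x \<in> A} \<longleftrightarrow> x \<in> C A"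
      by eventually_elim (auto simp: C_def)
    show "{x \<in> space (borel_vec d). ?n x \<in> A} \<in> sets (gauss_vec d)"
      unfolding sets_gauss_vec by measurable
  qed (simp add: sets_gauss_vec mC A)
  have "1 = \<kappa> * emeasure ?L ?pb"
  proof -
    have "1 = emeasure (gauss_vec d) (space (gauss_vec d))" by (simp add: gauss_vec.emeasure_space_1)
    also have "\<dots> = emeasure (gauss_vec d) {x \<in> space (borel_vec d). ?n x \<in> space (borel_vec d)}"
      by (auto simp: space_gauss_vec space_PiM intro!: arg_cong2[where f = emeasure])
    also have "\<dots> = \<kappa> * emeasure ?L {x \<in> ?pb. ?n x \<in> space (borel_vec d)}"
      by (simp add: split gC)
    also have "{x \<in> ?pb. ?n x \<in> space (borel_vec d)} = ?pb"
      by (auto simp: space_PiM)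
    finally show ?thesis .
  qed
  note vol = punctured_ball_volume[OF d]
  have \<kappa>_eq: "\<kappa> = 1 / emeasure ?L ?pb"
    using vol ennreal_mult_divide_eq[of "emeasure ?L ?pb" \<kappa>] \<open>1 = \<kappa> * emeasure ?L ?pb\<close> by simp
  show ?thesis
  proof (rule measure_eqI)
    show "sets (unif_sphere d) = sets (distr (gauss_vec d) (borel_vec d) ?n)"
      by (simp add: unif_sphere_def)
    fix A assume "A \<in> sets (unif_sphere d)"
    then have A[measurable]: "A \<in> sets (borel_vec d)" by (simp add: unif_sphere_def)
    have m: "{x \<in> space (borel_vec d). ?n x \<in> A} \<in> sets ?L"
      unfolding sets_lborel_vec by measurable
    have pre: "?n -` A \<inter> space (borel_vec d) = {x \<in> space (borel_vec d). ?n x \<in> A}" by auto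
    have sp: "space ?L = space (borel_vec d)" "space (gauss_vec d) = space (borel_vec d)"
      by (simp_all add: space_PiM space_gauss_vec)
    have "emeasure (unif_sphere d) A = emeasure (uniform_measure ?L ?pb) {x \<in> space (borel_vec d). ?n x \<in> A}"
      unfolding unif_sphere_def using A by (subst emeasure_distr) (simp_all add: sp pre)
    also have "\<dots> = emeasure ?L (?pb \<inter> {x \<in> space (borel_vec d). ?n x \<in> A}) / emeasure ?L ?pb"
      using m by (intro emeasure_uniform_measure) auto
    also have "?pb \<inter> {x \<in> space (borel_vec d). ?n x \<in> A} = {x \<in> ?pb. ?n x \<in> A}"
      by (auto simp: punctured_ball_def space_PiM)
    also have "emeasure ?L {x \<in> ?pb. ?n x \<in> A} / emeasure ?L ?pb = \<kappa> * emeasure ?L {x \<in> ?pb. ?n x \<in> A}"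
      by (simp add: \<kappa>_eq ennreal_divide_times)
    also have "\<dots> = emeasure (gauss_vec d) {x \<in> space (borel_vec d). ?n x \<in> A}"
      by (simp add: split gC)
    also have "\<dots> = emeasure (distr (gauss_vec d) (borel_vec d) ?n) A"
      using A by (subst emeasure_distr) (simp_all add: sp pre)
    finally show "emeasure (unif_sphere d) A = emeasure (distr (gauss_vec d) (borel_vec d) ?n) A" .
  qed
qed

section \<open>One projection of the uniform direction\<close>

lemma std_normal_UNIV: "std_normal.prob UNIV = 1"
  using std_normal.prob_space by simp

text \<open>
  Centred independent terms are orthogonal in \<open>L\<^sup>2\<close>. The expectation of each product
  \<open>f k (x k) * f l (x l)\<close> is taken by writing it as a product over all coordinates.
\<close>

lemma gauss_vec_centred_sum_square:
  fixes f :: "nat \<Rightarrow> real \<Rightarrow> real"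
  assumes f: "\<And>k. integrable std_normal_distribution (f k)"
    and f2: "\<And>k. integrable std_normal_distribution (\<lambda>y. (f k y)\<^sup>2)"
    and centred: "\<And>k. (\<integral>y. f k y \<partial>std_normal_distribution) = 0"
  shows "has_bochner_integral (gauss_vec d) (\<lambda>x. (\<Sum>k<d. f k (x k))\<^sup>2)
           (\<Sum>k<d. \<integral>y. (f k y)\<^sup>2 \<partial>std_normal_distribution)"
proof -
  have pair: "has_bochner_integral (gauss_vec d) (\<lambda>x. f k (x k) * f l (x l))
      (if k = l then \<integral>y. (f k y)\<^sup>2 \<partial>std_normal_distribution else 0)"
    if kl: "k < d" "l < d" for k l
  proof -
    define h where "h i y = (if i = k then f k y else 1) * (if i = l then f l y else 1)" for i y
    have int_h: "integrable std_normal_distribution (h i)" for i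
      unfolding h_def[abs_def] using f f2 by (cases "i = k"; cases "i = l") (auto simp: power2_eq_square)
    have prod_h: "(\<Prod>i<d. h i (x i)) = f k (x k) * f l (x l)" for x
      using kl by (simp add: h_def prod.distrib prod.delta)
    have one: "(\<integral>y. h i y \<partial>std_normal_distribution) = 
       (if i = k then if k = l then \<integral>y. (f k y)\<^sup>2 \<partial>std_normal_distribution else 0 else if i = l then 0 else 1)" for i
      using centred by (auto simp: h_def power2_eq_square std_normal_UNIV)
    have "integrable (gauss_vec d) (\<lambda>x. \<Prod>i<d. h i (x i))"
      unfolding gauss_vec_def by (rule gauss_factors.product_integrable_prod) (use int_h in auto)
    moreover have "(\<integral>x. (\<Prod>i<d. h i (x i)) \<partial>gauss_vec d) = (\<Prod>i<d. \<integral>y. h i y \<partial>std_normal_distribution)"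
      unfolding gauss_vec_def by (rule gauss_factors.product_integral_prod) (use int_h in auto)
    moreover have "(\<Prod>i<d. \<integral>y. h i y \<partial>std_normal_distribution)
        = (if k = l then \<integral>y. (f k y)\<^sup>2 \<partial>std_normal_distribution else 0)"
    proof (cases "k = l")
      case True
      then have "(\<Prod>i<d. \<integral>y. h i y \<partial>std_normal_distribution) =
        (\<Prod>i<d. if i = k then \<integral>y. (f k y)\<^sup>2 \<partial>std_normal_distribution else 1)"
        by (intro prod.cong) (auto simp: one)
      then show ?thesis using True kl by simp
    next
      case False
      then show ?thesis using kl by (auto simp: one intro!: prod_zero)
    qed
    ultimately show ?thesis
      by (simp add: has_bochner_integral_iff prod_h)
  qed
  have "has_bochner_integral (gauss_vec d) (\<lambda>x. \<Sum>k<d. \<Sum>l<d. f k (x k) * f l (x l))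
     (\<Sum>k<d. \<Sum>l<d. if k = l then \<integral>y. (f k y)\<^sup>2 \<partial>std_normal_distribution else 0)"
    by (intro has_bochner_integral_sum pair) auto
  then show ?thesis
    by (simp add: power2_eq_square sum_product)
qed

lemma std_normal_moments:
  "integrable std_normal_distribution (\<lambda>y. y)" "(\<integral>y. y \<partial>std_normal_distribution) = 0"
  "integrable std_normal_distribution (\<lambda>y. y\<^sup>2)" "(\<integral>y. y\<^sup>2 \<partial>std_normal_distribution) = 1"
  "integrable std_normal_distribution (\<lambda>y. y ^ 4)" "(\<integral>y. y ^ 4 \<partial>std_normal_distribution) = 3"
  using integrable_std_normal_distribution_moment[of 1] integral_std_normal_distribution_moment_odd[of 1]
    std_normal_distribution_even_moments[of 1] std_normal_distribution_even_moments[of 2]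
  by (simp_all add: fact_numeral)

lemma gauss_vec_inner_second_moment:
  "has_bochner_integral (gauss_vec d) (\<lambda>x. (inner_vec d x w)\<^sup>2) (\<Sum>k<d. (w k)\<^sup>2)"
proof -
  have "has_bochner_integral (gauss_vec d) (\<lambda>x. (\<Sum>k<d. x k * w k)\<^sup>2)
      (\<Sum>k<d. \<integral>y. (y * w k)\<^sup>2 \<partial>std_normal_distribution)"
    by (rule gauss_vec_centred_sum_square)
      (auto simp: std_normal_moments power_mult_distrib)
  then show ?thesis by (simp add: power_mult_distrib std_normal_moments)
qed

text \<open>
  The law of large numbers for the squared norm of a Gaussian vector, as an exact variance:
  \<open>\<parallel>x\<parallel>\<^sup>2 - d\<close> is a sum of \<open>d\<close> centred independent terms of variance 2.
\<close>

lemma gauss_vec_norm_concentration: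
  assumes "d \<ge> 1"
  shows "has_bochner_integral (gauss_vec d) (\<lambda>x. (1 - (L2_set x {..<d})\<^sup>2 / real d)\<^sup>2) (2 / real d)"
proof -
  have sq: "(y\<^sup>2 - 1)\<^sup>2 = y ^ 4 - 2 * y\<^sup>2 + 1" for y :: real
    by (simp add: power2_diff flip: power_mult)
  have "has_bochner_integral (gauss_vec d) (\<lambda>x. (\<Sum>k<d. (x k)\<^sup>2 - 1)\<^sup>2)
      (\<Sum>k<d. \<integral>y. (y\<^sup>2 - 1)\<^sup>2 \<partial>std_normal_distribution)"
    by (rule gauss_vec_centred_sum_square)
      (auto simp: std_normal_moments sq std_normal_UNIV)
  also have "(\<integral>y. (y\<^sup>2 - 1)\<^sup>2 \<partial>std_normal_distribution) = 2"
    by (simp add: sq std_normal_moments std_normal_UNIV)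
  finally have "has_bochner_integral (gauss_vec d) (\<lambda>x. (1 / (real d)\<^sup>2) * (\<Sum>k<d. (x k)\<^sup>2 - 1)\<^sup>2)
      ((1 / (real d)\<^sup>2) * (\<Sum>k<d. 2))"
    by (intro has_bochner_integral_mult_right) auto
  moreover have "(1 / (real d)\<^sup>2) * (\<Sum>k<d. (x k)\<^sup>2 - 1)\<^sup>2 = (1 - (L2_set x {..<d})\<^sup>2 / real d)\<^sup>2" for x
  proof -
    have "1 - (L2_set x {..<d})\<^sup>2 / real d = - ((\<Sum>k<d. (x k)\<^sup>2 - 1) / real d)"
      using assms by (simp add: L2_set_def sum_nonneg sum_subtractf diff_divide_distrib)
    then show ?thesis by (simp add: power_divide)
  qed
  moreover have "(1 / (real d)\<^sup>2) * (\<Sum>k<d. 2) = 2 / real d"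
    using assms by (simp add: power2_eq_square)
  ultimately show ?thesis by simp
qed

lemma gauss_vec_char:
  "(CLINT x|gauss_vec d. iexp (inner_vec d x w)) = exp (- (\<Sum>k<d. (w k)\<^sup>2) / 2)"
proof -
  have "(CLINT x|gauss_vec d. iexp (inner_vec d x w)) = (CLINT x|gauss_vec d. (\<Prod>k<d. iexp (w k * x k)))"
    by (simp add: sum_distrib_left exp_sum mult_ac)
  also have "\<dots> = (\<Prod>k<d. CLINT y|std_normal_distribution. iexp (w k * y))"
    unfolding gauss_vec_def
    by (rule gauss_factors.product_integral_prod) (auto intro: std_normal.integrable_iexp)
  also have "\<dots> = (\<Prod>k<d. char std_normal_distribution (w k))"
    by (simp add: char_def)
  also have "\<dots> = of_real (\<Prod>k<d. exp (- (w k)\<^sup>2 / 2))"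
    by (simp add: char_std_normal_distribution)
  also have "(\<Prod>k<d. exp (- (w k)\<^sup>2 / 2)) = exp (- (\<Sum>k<d. (w k)\<^sup>2) / 2)"
    by (simp add: exp_sum[symmetric] sum_negf sum_divide_distrib)
  finally show ?thesis .
qed

lemma cmod_iexp_diff: "cmod (iexp a - iexp b) \<le> \<bar>a - b\<bar>"
proof -
  have "iexp a - iexp b = iexp b * (iexp (a - b) - 1)"
    by (simp add: algebra_simps flip: exp_add)
  then have "cmod (iexp a - iexp b) = cmod (iexp (a - b) - 1)"
    by (simp add: norm_mult)
  also have "\<dots> \<le> \<bar>a - b\<bar>"
    using iexp_approx1[of "a - b" 0] by simp
  finally show ?thesis .
qed

text \<open>
  This compares the characteristic exponentials of a linear form before and after normalisation;
  \<open>s\<close> will be the norm divided by its typical size \<open>sqrt d\<close>. The right-hand side contains only squares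
  of \<open>b\<close> and of \<open>1 - s\<^sup>2\<close>, whose Gaussian expectations are explicit, and \<open>\<epsilon>\<close> is left free to balance
  them. Where \<open>s \<ge> 1/2\<close> the exponential is Lipschitz and \<open>1/s\<close> is bounded; where \<open>s < 1/2\<close> the trivial
  bound 2 is absorbed because \<open>1 - s\<^sup>2\<close> is not small.
\<close>

lemma cmod_iexp_diff_ratio:
  fixes b s \<epsilon> :: real
  assumes s: "0 \<le> s" and e: "0 < \<epsilon>"
  shows "cmod (iexp (b / s) - iexp b) \<le> \<epsilon> * b\<^sup>2 + 3 * (1 - s\<^sup>2)\<^sup>2 / \<epsilon> + 2 * \<epsilon>"
proof -
  define q where "q = \<bar>1 - s\<^sup>2\<bar>"
  have amgm: "2 * x * y \<le> \<epsilon> * x\<^sup>2 + y\<^sup>2 / \<epsilon>" for x y :: real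
  proof -
    have "0 \<le> (\<epsilon> * x - y)\<^sup>2 / \<epsilon>" using e by simp
    also have "\<dots> = \<epsilon> * x\<^sup>2 + y\<^sup>2 / \<epsilon> - 2 * x * y"
      using e by (simp add: power2_eq_square field_simps)
    finally show ?thesis by simp
  qed
  have "cmod (iexp (b / s) - iexp b) \<le> 2 * \<bar>b\<bar> * q + 4 * q"
  proof (cases "1/2 \<le> s")
    case True
    have "q = \<bar>1 - s\<bar> * (1 + s)"
    proof -
      have "1 - s\<^sup>2 = (1 - s) * (1 + s)" by (simp add: power2_eq_square algebra_simps)
      then show ?thesis using s by (simp add: q_def abs_mult)
    qed
    then have 1: "\<bar>1 - s\<bar> \<le> q" using s by (simp add: mult_le_cancel_left1)
    have "cmod (iexp (b / s) - iexp b) \<le> \<bar>b / s - b\<bar>" by (rule cmod_iexp_diff)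
    also have "\<dots> = \<bar>b\<bar> * (\<bar>1 - s\<bar> / s)"
    proof -
      have "b / s - b = b * ((1 - s) / s)" using True by (simp add: field_simps)
      then show ?thesis using True by (simp add: abs_mult)
    qed
    also have "\<dots> \<le> \<bar>b\<bar> * (2 * q)"
    proof (rule mult_left_mono)
      have "\<bar>1 - s\<bar> \<le> 2 * q * s"
        using True 1 mult_left_mono[of 1 "2 * s" q] by (simp add: q_def mult_ac)
      then show "\<bar>1 - s\<bar> / s \<le> 2 * q" using True by (simp add: divide_le_eq)
    qed simp
    finally have "cmod (iexp (b / s) - iexp b) \<le> \<bar>b\<bar> * (2 * q)" .
    moreover have "0 \<le> q" by (simp add: q_def)
    ultimately show ?thesis by linarith
  next
    case False
    then have "s\<^sup>2 \<le> (1/2)\<^sup>2" using s by (intro power_mono) auto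
    then have "1/2 \<le> q" by (simp add: q_def power2_eq_square)
    moreover have "cmod (iexp (b / s) - iexp b) \<le> 2"
      using norm_triangle_ineq4[of "iexp (b / s)" "iexp b"] by simp
    moreover have "0 \<le> 2 * \<bar>b\<bar> * q" by (simp add: q_def)
    ultimately show ?thesis by linarith
  qed
  also have "\<dots> \<le> (\<epsilon> * \<bar>b\<bar>\<^sup>2 + q\<^sup>2 / \<epsilon>) + 2 * (\<epsilon> + q\<^sup>2 / \<epsilon>)"
    using amgm[of "\<bar>b\<bar>" q] amgm[of 1 q] by simp
  also have "\<dots> = \<epsilon> * b\<^sup>2 + 3 * (1 - s\<^sup>2)\<^sup>2 / \<epsilon> + 2 * \<epsilon>"
    by (simp add: q_def)
  finally show ?thesis .
qed

text \<open>
  For a Gaussian \<open>x\<close> and the direction \<open>v\<close> of \<open>x\<close>, the form \<open>sqrt d * \<langle>v, w\<rangle>\<close> is the Gaussian form \<open>\<langle>x, w\<rangle>\<close>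
  divided by \<open>\<parallel>x\<parallel> / sqrt d\<close>, a quantity close to 1.
\<close>

lemma unif_sphere_scaled_inner:
  fixes g :: "real \<Rightarrow> 'b :: {banach, second_countable_topology}"
  assumes d: "d \<ge> 1" and [measurable]: "g \<in> borel_measurable borel"
  shows "(\<integral>v. g (sqrt (real d) * inner_vec d v w) \<partial>unif_sphere d)
           = (\<integral>x. g (inner_vec d x w / (L2_set x {..<d} / sqrt (real d))) \<partial>gauss_vec d)"
proof -
  have eq: "sqrt (real d) * inner_vec d (\<lambda>k\<in>{..<d}. x k / L2_set x {..<d}) w
      = inner_vec d x w / (L2_set x {..<d} / sqrt (real d))" for x
    by (simp add: sum_divide_distrib sum_distrib_left mult_ac)
  have "(\<integral>v. g (sqrt (real d) * inner_vec d v w) \<partial>unif_sphere d)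
     = (\<integral>x. g (sqrt (real d) * inner_vec d (\<lambda>k\<in>{..<d}. x k / L2_set x {..<d}) w) \<partial>gauss_vec d)"
    unfolding unif_sphere_eq_gauss_direction[OF d] by (rule integral_distr) measurable
  then show ?thesis unfolding eq .
qed

text \<open>
  An explicit rate makes the estimate uniform over all \<open>w\<close> of bounded norm; the choice
  \<open>\<epsilon> = 1 / sqrt d\<close> balances the terms of the pointwise bound.
\<close>

lemma unif_sphere_char:
  assumes d: "d \<ge> 1"
  shows "cmod ((CLINT v|unif_sphere d. iexp (sqrt (real d) * inner_vec d v w)) - exp (- (\<Sum>k<d. (w k)\<^sup>2) / 2))
           \<le> ((\<Sum>k<d. (w k)\<^sup>2) + 8) / sqrt (real d)"
proof -
  let ?b = "\<lambda>x. inner_vec d x w" and ?s = "\<lambda>x. L2_set x {..<d} / sqrt (real d)"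
  define \<epsilon> where "\<epsilon> = 1 / sqrt (real d)"
  have e: "0 < \<epsilon>" using d by (simp add: \<epsilon>_def)
  have [measurable]: "?b \<in> borel_measurable (gauss_vec d)" "?s \<in> borel_measurable (gauss_vec d)"
    by measurable
  have int: "integrable (gauss_vec d) (\<lambda>x. iexp (?b x / ?s x))" "integrable (gauss_vec d) (\<lambda>x. iexp (?b x))"
    by (intro gauss_vec.integrable_iexp; measurable)+
  have s2: "(?s x)\<^sup>2 = (L2_set x {..<d})\<^sup>2 / real d" for x
    by (simp add: power_divide)
  have bnd: "has_bochner_integral (gauss_vec d) (\<lambda>x. \<epsilon> * (?b x)\<^sup>2 + 3 * (1 - (?s x)\<^sup>2)\<^sup>2 / \<epsilon> + 2 * \<epsilon>)
     (\<epsilon> * (\<Sum>k<d. (w k)\<^sup>2) + 3 * (2 / real d) / \<epsilon> + 2 * \<epsilon>)"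
    unfolding s2 using gauss_vec_norm_concentration[OF d] gauss_vec_inner_second_moment[of d w]
    by (intro has_bochner_integral_add has_bochner_integral_mult_right has_bochner_integral_divide_zero)
      (auto simp: has_bochner_integral_iff gauss_vec.prob_space)
  have "(CLINT v|unif_sphere d. iexp (sqrt (real d) * inner_vec d v w)) - exp (- (\<Sum>k<d. (w k)\<^sup>2) / 2)
      = (CLINT x|gauss_vec d. iexp (?b x / ?s x) - iexp (?b x))"
    unfolding Bochner_Integration.integral_diff[OF int] gauss_vec_char
    by (subst unif_sphere_scaled_inner[OF d, where g = iexp]) simp_all
  also have "cmod \<dots> \<le> (\<integral>x. cmod (iexp (?b x / ?s x) - iexp (?b x)) \<partial>gauss_vec d)"
    by (rule integral_norm_bound)
  also have "\<dots> \<le> (\<integral>x. \<epsilon> * (?b x)\<^sup>2 + 3 * (1 - (?s x)\<^sup>2)\<^sup>2 / \<epsilon> + 2 * \<epsilon> \<partial>gauss_vec d)"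
    using int bnd e by (intro integral_mono cmod_iexp_diff_ratio integrable_norm Bochner_Integration.integrable_diff)
       (auto simp: has_bochner_integral_iff)
  also have "\<dots> = \<epsilon> * (\<Sum>k<d. (w k)\<^sup>2) + 3 * (2 / real d) / \<epsilon> + 2 * \<epsilon>"
    using bnd by (simp add: has_bochner_integral_iff)
  also have "\<dots> = ((\<Sum>k<d. (w k)\<^sup>2) + 8) / sqrt (real d)"
  proof -
    have "(2 / real d) / \<epsilon> = 2 / sqrt (real d)"
      using d by (simp add: \<epsilon>_def field_simps)
    then have "3 * (2 / real d) / \<epsilon> = 6 / sqrt (real d)" by simp
    then show ?thesis by (simp add: \<epsilon>_def add_divide_distrib)
  qed
  finally show ?thesis .
qed

text \<open>
  If \<open>\<bar>b / s\<bar> > K\<close>, then either \<open>\<bar>b\<bar> \<ge> K/2\<close> or \<open>s < 1/2\<close>; each alternative is paid for by a second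
  moment of the Gaussian vector.
\<close>

lemma unif_sphere_tail:
  assumes d: "d \<ge> 1" and K: "0 < K"
  shows "measure (unif_sphere d) {v \<in> space (unif_sphere d). \<bar>sqrt (real d) * inner_vec d v w\<bar> > K}
           \<le> 4 * (\<Sum>k<d. (w k)\<^sup>2) / K\<^sup>2 + 4 / real d"
proof -
  let ?b = "\<lambda>x. inner_vec d x w" and ?s = "\<lambda>x. L2_set x {..<d} / sqrt (real d)"
  let ?g = "\<lambda>y. indicat_real {y. \<bar>y\<bar> > K} y"
  have [measurable]: "?b \<in> borel_measurable (gauss_vec d)" "?s \<in> borel_measurable (gauss_vec d)"
    by measurable
  have s2: "(?s x)\<^sup>2 = (L2_set x {..<d})\<^sup>2 / real d" for x
    by (simp add: power_divide)
  interpret S: prob_space "unif_sphere d" using d by (rule prob_space_unif_sphere)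
  have [measurable_cong]: "sets (unif_sphere d) = sets (borel_vec d)" by (simp add: unif_sphere_def)
  have bnd: "has_bochner_integral (gauss_vec d) (\<lambda>x. 4 / K\<^sup>2 * (?b x)\<^sup>2 + 2 * (1 - (?s x)\<^sup>2)\<^sup>2)
     (4 / K\<^sup>2 * (\<Sum>k<d. (w k)\<^sup>2) + 2 * (2 / real d))"
    unfolding s2 using gauss_vec_norm_concentration[OF d] gauss_vec_inner_second_moment[of d w]
    by (intro has_bochner_integral_add has_bochner_integral_mult_right) auto
  have "measure (unif_sphere d) {v \<in> space (unif_sphere d). \<bar>sqrt (real d) * inner_vec d v w\<bar> > K}
     = (\<integral>v. indicat_real {v \<in> space (unif_sphere d). \<bar>sqrt (real d) * inner_vec d v w\<bar> > K} v \<partial>unif_sphere d)"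
    by (simp add: )
  also have "\<dots> = (\<integral>v. ?g (sqrt (real d) * inner_vec d v w) \<partial>unif_sphere d)"
    by (intro Bochner_Integration.integral_cong) (auto simp: indicator_def)
  also have "\<dots> = (\<integral>x. ?g (?b x / ?s x) \<partial>gauss_vec d)"
    by (rule unif_sphere_scaled_inner[OF d]) measurable
  also have "\<dots> \<le> (\<integral>x. 4 / K\<^sup>2 * (?b x)\<^sup>2 + 2 * (1 - (?s x)\<^sup>2)\<^sup>2 \<partial>gauss_vec d)"
  proof (rule integral_mono)
    show "integrable (gauss_vec d) (\<lambda>x. ?g (?b x / ?s x))"
      by (rule gauss_vec.integrable_const_bound[where B = 1]) (auto simp: indicator_def)
    show "integrable (gauss_vec d) (\<lambda>x. 4 / K\<^sup>2 * (?b x)\<^sup>2 + 2 * (1 - (?s x)\<^sup>2)\<^sup>2)"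
      using bnd by (simp add: has_bochner_integral_iff)
    fix x
    show "?g (?b x / ?s x) \<le> 4 / K\<^sup>2 * (?b x)\<^sup>2 + 2 * (1 - (?s x)\<^sup>2)\<^sup>2"
    proof (cases "\<bar>?b x / ?s x\<bar> > K")
      case big: True
      show ?thesis
      proof (cases "1/2 \<le> ?s x")
        case True
        have "K * (1/2) \<le> K * ?s x" using True K by (intro mult_left_mono) auto
        also have "\<dots> \<le> \<bar>?b x\<bar>"
        proof -
          have "\<bar>?b x / ?s x\<bar> = \<bar>?b x\<bar> / ?s x" using True by (subst abs_divide, subst abs_of_nonneg[of "?s x"]) auto
          then show ?thesis using big True pos_less_divide_eq[of "?s x" K "\<bar>?b x\<bar>"] by linarith
        qed
        finally have "(K / 2)\<^sup>2 \<le> \<bar>?b x\<bar>\<^sup>2" using K by (intro power_mono) auto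
        then have "1 \<le> 4 / K\<^sup>2 * (?b x)\<^sup>2" using K by (simp add: power_divide field_simps)
        then show ?thesis using big by (simp add: add_increasing2)
      next
        case False
        then have "(?s x)\<^sup>2 \<le> (1/2)\<^sup>2" by (intro power_mono) auto
        then have "(3/4)\<^sup>2 \<le> (1 - (?s x)\<^sup>2)\<^sup>2" by (intro power_mono) (auto simp: power2_eq_square)
        moreover have "(3/4 :: real)\<^sup>2 = 9/16" by (simp add: power2_eq_square)
        ultimately have "1 \<le> 2 * (1 - (?s x)\<^sup>2)\<^sup>2" by linarith
        moreover have "0 \<le> 4 / K\<^sup>2 * (?b x)\<^sup>2" by simp
        moreover have "?g (?b x / ?s x) \<le> 1" by (simp add: indicator_def)
        ultimately show ?thesis by linarith
      qed
    qed simp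
  qed
  also have "\<dots> = 4 / K\<^sup>2 * (\<Sum>k<d. (w k)\<^sup>2) + 2 * (2 / real d)"
    using bnd by (simp add: has_bochner_integral_iff)
  finally show ?thesis by simp
qed

section \<open>Levy's continuity theorem in several dimensions\<close>

text \<open>
  Lebesgue measure on \<open>real ^ 'n\<close> is the image of the product measure indexed by the standard basis;
  the proof re-indexes the basis by \<open>'n\<close>.
\<close>

lemma lborel_cart_integral_prod:
  fixes h :: "'n::finite \<Rightarrow> real \<Rightarrow> 'b::{real_normed_field, banach, second_countable_topology}"
  assumes h: "\<And>i. integrable lborel (h i)"
  shows "has_bochner_integral lborel (\<lambda>x::real^'n. \<Prod>i\<in>UNIV. h i (x $ i)) (\<Prod>i\<in>UNIV. \<integral>y. h i y \<partial>lborel)"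
proof -
  interpret product_sigma_finite "\<lambda>_::real^'n. lborel :: real measure" by standard
  let ?e = "\<lambda>i::'n. axis i (1::real)"
  have bij: "bij_betw ?e UNIV Basis"
    by (auto simp: bij_betw_def inj_on_def axis_eq_axis Basis_vec_def)
  define ix where "ix = the_inv_into UNIV ?e"
  have ix: "ix (?e i) = i" for i
    unfolding ix_def using bij by (intro the_inv_into_f_f) (auto simp: bij_betw_def)
  have prod_eq: "(\<Prod>b\<in>Basis. g b) = (\<Prod>i\<in>UNIV. g (?e i))" for g :: "real^'n \<Rightarrow> 'b"
    by (rule prod.reindex_bij_betw[OF bij, symmetric])
  have comp: "(\<Sum>b\<in>Basis. f b *\<^sub>R b) $ i = f (?e i)" for f :: "real^'n \<Rightarrow> real" and i
  proof -
    have "(\<Sum>b\<in>Basis. f b *\<^sub>R b) $ i = (\<Sum>j\<in>UNIV. (f (?e j) *\<^sub>R ?e j) $ i)"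
      by (simp add: sum.reindex_bij_betw[OF bij, symmetric])
    also have "\<dots> = (\<Sum>j\<in>UNIV. if j = i then f (?e j) else 0)"
      by (intro sum.cong) (auto simp: axis_def)
    finally show ?thesis by simp
  qed
  have comp': "(\<Sum>b\<in>Basis. f b * b $ i) = f (?e i)" for f :: "real^'n \<Rightarrow> real" and i
    using comp by simp
  have [measurable]: "h i \<in> borel_measurable borel" for i
    using h[of i] by auto
  have m: "(\<lambda>x::real^'n. \<Prod>i\<in>UNIV. h i (x $ i)) \<in> borel_measurable borel"
    by measurable
  have "integrable (\<Pi>\<^sub>M b\<in>(Basis :: (real^'n) set). lborel) (\<lambda>f. \<Prod>b\<in>Basis. h (ix b) (f b))"
    by (rule product_integrable_prod) (use h in auto)
  moreover have "(\<integral>f. (\<Prod>b\<in>Basis. h (ix b) (f b)) \<partial>(\<Pi>\<^sub>M b\<in>(Basis :: (real^'n) set). lborel))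
      = (\<Prod>b\<in>Basis. \<integral>y. h (ix b) y \<partial>lborel)"
    by (rule product_integral_prod) (use h in auto)
  ultimately show ?thesis
    unfolding has_bochner_integral_iff
    using m by (subst (1 2) lborel_eq) (simp add: integrable_distr_eq integral_distr comp' prod_eq ix)
qed

text \<open>
  The density of \<^const>\<open>std_normal_vec\<close> as a real function; translated and rescaled, it serves as
  smoothing kernel.
\<close>

definition normal_kernel :: "real ^ 'n \<Rightarrow> real" where
  "normal_kernel x = (\<Prod>i\<in>UNIV. std_normal_density (x $ i))"

lemma normal_kernel_eq:
  "normal_kernel (x :: real^'n) = (1 / sqrt (2 * pi)) ^ CARD('n) * exp (- (norm x)\<^sup>2 / 2)"
proof -
  have "normal_kernel x = (1 / sqrt (2 * pi)) ^ CARD('n) * (\<Prod>i\<in>UNIV. exp (- (x $ i)\<^sup>2 / 2))"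
    unfolding normal_kernel_def std_normal_density_def prod.distrib by simp
  also have "(\<Prod>i\<in>UNIV. exp (- (x $ i)\<^sup>2 / 2)) = exp (\<Sum>i\<in>UNIV. - (x $ i)\<^sup>2 / 2)"
    by (simp add: exp_sum)
  also have "(\<Sum>i\<in>UNIV. - (x $ i)\<^sup>2 / 2) = - (norm x)\<^sup>2 / 2"
    by (simp add: norm_vec_def L2_set_def sum_nonneg sum_negf sum_divide_distrib)
  finally show ?thesis .
qed

lemma normal_kernel_nonneg: "0 \<le> normal_kernel x"
  by (simp add: normal_kernel_def prod_nonneg)

lemma normal_kernel_le: "normal_kernel (x :: real^'n) \<le> (1 / sqrt (2 * pi)) ^ CARD('n)"
  unfolding normal_kernel_eq by (intro mult_left_le) auto

lemma normal_kernel_measurable [measurable]: "normal_kernel \<in> borel_measurable borel"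
  unfolding normal_kernel_def[abs_def] by measurable

lemma normal_kernel_integral:
  "has_bochner_integral lborel (normal_kernel :: real^'n \<Rightarrow> real) 1"
proof -
  have "has_bochner_integral lborel (\<lambda>x::real^'n. \<Prod>i\<in>UNIV. std_normal_density (x $ i))
      (\<Prod>i\<in>(UNIV::'n set). \<integral>y. std_normal_density y \<partial>lborel)"
    by (rule lborel_cart_integral_prod) (simp add: integrable_normal_density)
  then show ?thesis by (simp add: normal_kernel_def[abs_def])
qed

lemma std_normal_vec_eq: "std_normal_vec = density lborel (\<lambda>x. ennreal (normal_kernel x))"
  by (simp add: std_normal_vec_def normal_kernel_def)

lemma sets_std_normal_vec [measurable_cong]: "sets std_normal_vec = sets borel"
  by (simp add: std_normal_vec_def)

lemma integral_std_normal_vec: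
  fixes g :: "real^'n \<Rightarrow> 'b::{banach, second_countable_topology}"
  assumes "g \<in> borel_measurable borel"
  shows "(\<integral>x. g x \<partial>std_normal_vec) = (\<integral>x. normal_kernel x *\<^sub>R g x \<partial>lborel)"
    and "integrable std_normal_vec g \<longleftrightarrow> integrable lborel (\<lambda>x. normal_kernel x *\<^sub>R g x)"
  unfolding std_normal_vec_eq
  using assms by (subst integral_density; simp add: normal_kernel_nonneg)
    (use assms in \<open>subst integrable_density; simp add: normal_kernel_nonneg\<close>)

lemma prob_space_std_normal_vec: "prob_space (std_normal_vec :: (real^'n) measure)"
proof (rule prob_spaceI)
  have "emeasure (std_normal_vec :: (real^'n) measure) (space std_normal_vec)
      = (\<integral>\<^sup>+x. ennreal (normal_kernel (x :: real^'n)) \<partial>lborel)"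
    unfolding std_normal_vec_eq by (simp add: emeasure_density)
  also have "\<dots> = ennreal (\<integral>x. normal_kernel (x :: real^'n) \<partial>lborel)"
    using normal_kernel_integral normal_kernel_nonneg
    by (intro nn_integral_eq_integral) (auto simp: has_bochner_integral_iff)
  finally show "emeasure (std_normal_vec :: (real^'n) measure) (space std_normal_vec) = 1"
    using normal_kernel_integral[where 'n='n] by (simp add: has_bochner_integral_iff)
qed

interpretation std_normal_vec: prob_space std_normal_vec
  by (rule prob_space_std_normal_vec)

lemma std_normal_vec_char:
  fixes t :: "real^'n"
  shows "(CLINT x|std_normal_vec. iexp (t \<bullet> x)) = exp (- (norm t)\<^sup>2 / 2)"
proof -
  have int: "complex_integrable lborel (\<lambda>y. of_real (std_normal_density y) * iexp (t $ i * y))" for i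
    using std_normal.integrable_iexp[of "\<lambda>y. t $ i * y"]
    by (simp add: integrable_density scaleR_conv_of_real)
  have one: "(CLBINT y. of_real (std_normal_density y) * iexp (t $ i * y)) = of_real (exp (- (t $ i)\<^sup>2 / 2))" for i
  proof -
    have "char std_normal_distribution (t $ i) = (CLBINT y. of_real (std_normal_density y) * iexp (t $ i * y))"
      unfolding char_def by (subst integral_density) (auto simp: scaleR_conv_of_real)
    then show ?thesis by (simp add: char_std_normal_distribution)
  qed
  have "(CLINT x|std_normal_vec. iexp (t \<bullet> x)) = (CLBINT x. normal_kernel x *\<^sub>R iexp (t \<bullet> x))"
    by (rule integral_std_normal_vec) measurable
  also have "\<dots> = (CLBINT x. (\<Prod>i\<in>UNIV. of_real (std_normal_density (x $ i)) * iexp (t $ i * x $ i)))"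
    by (simp add: normal_kernel_def inner_vec_def prod.distrib scaleR_conv_of_real exp_sum sum_distrib_left)
  also have "\<dots> = (\<Prod>i\<in>UNIV. of_real (exp (- (t $ i)\<^sup>2 / 2)))"
    using lborel_cart_integral_prod[of "\<lambda>i y. of_real (std_normal_density y) * iexp (t $ i * y)", OF int]
    unfolding has_bochner_integral_iff one by (rule conjunct2)
  also have "\<dots> = of_real (\<Prod>i\<in>UNIV. exp (- (t $ i)\<^sup>2 / 2))" by simp
  also have "(\<Prod>i\<in>UNIV. exp (- (t $ i)\<^sup>2 / 2)) = exp (\<Sum>i\<in>UNIV. - (t $ i)\<^sup>2 / 2)"
    by (simp add: exp_sum)
  also have "(\<Sum>i\<in>UNIV. - (t $ i)\<^sup>2 / 2) = - (norm t)\<^sup>2 / 2"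
    by (simp add: norm_vec_def L2_set_def sum_nonneg sum_negf sum_divide_distrib)
  finally show ?thesis .
qed

lemma std_normal_vec_second_moment: "integrable std_normal_vec (\<lambda>x::real^'n. (norm x)\<^sup>2)"
proof -
  have one: "integrable std_normal_vec (\<lambda>x::real^'n. (x $ i)\<^sup>2)" for i
  proof -
    have "has_bochner_integral lborel (\<lambda>x::real^'n. \<Prod>j\<in>UNIV. std_normal_density (x $ j) * (if j = i then (x $ j)\<^sup>2 else 1))
       (\<Prod>j\<in>UNIV. \<integral>y. std_normal_density y * (if j = i then y\<^sup>2 else 1) \<partial>lborel)"
    proof (rule lborel_cart_integral_prod)
      fix j show "integrable lborel (\<lambda>y. std_normal_density y * (if j = i then y\<^sup>2 else 1))"
        using integrable_std_normal_moment[of 2] by (cases "j = i") (simp_all add: integrable_normal_density)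
    qed
    moreover have "(\<Prod>j\<in>UNIV. std_normal_density (x $ j) * (if j = i then (x $ j)\<^sup>2 else 1)) = normal_kernel x *\<^sub>R (x $ i)\<^sup>2" for x :: "real^'n"
      by (simp add: prod.distrib normal_kernel_def)
    ultimately show ?thesis
      by (subst integral_std_normal_vec) (auto simp: has_bochner_integral_iff)
  qed
  have "(norm x)\<^sup>2 = (\<Sum>i\<in>UNIV. (x $ i)\<^sup>2)" for x :: "real^'n"
    by (simp add: norm_vec_def L2_set_def sum_nonneg)
  then show ?thesis using one by simp
qed

lemma iexp_measurable_inner [measurable]:
  "(\<lambda>x::real^'n. iexp (t \<bullet> x)) \<in> borel_measurable borel"
  by measurable

text \<open>
  The Gaussian is, up to a constant, its own Fourier transform. Writing the kernel as an average of
  exponentials and exchanging the integrals expresses the density of the law \<open>\<mu>\<close> convolved with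
  \<open>N(0, \<sigma>\<^sup>2 I)\<close>, up to a factor, through the characteristic function of \<open>\<mu>\<close> alone.
\<close>

lemma smoothed_density_eq:
  fixes \<mu> :: "(real^'n) measure"
  assumes \<mu>: "prob_space \<mu>" "sets \<mu> = sets borel" and s: "0 < (\<sigma>::real)"
  shows "of_real (\<integral>y. normal_kernel ((x - y) /\<^sub>R \<sigma>) \<partial>\<mu>)
     = (1 / sqrt (2 * pi)) ^ CARD('n) *
       (CLINT t|std_normal_vec. iexp (t \<bullet> (x /\<^sub>R \<sigma>)) * (CLINT y|\<mu>. iexp ((- t /\<^sub>R \<sigma>) \<bullet> y)))"
proof -
  interpret \<mu>: prob_space \<mu> by fact
  interpret pair_prob_space \<mu> "std_normal_vec :: (real^'n) measure" ..
  note [measurable_cong] = \<mu>(2)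
  let ?c = "(1 / sqrt (2 * pi)) ^ CARD('n)"
  let ?g = "\<lambda>y t. iexp (t \<bullet> ((x - y) /\<^sub>R \<sigma>))"
  have "of_real (\<integral>y. normal_kernel ((x - y) /\<^sub>R \<sigma>) \<partial>\<mu>) = (CLINT y|\<mu>. of_real (normal_kernel ((x - y) /\<^sub>R \<sigma>)))"
    by simp
  also have "\<dots> = (CLINT y|\<mu>. of_real ?c * (CLINT t|std_normal_vec. ?g y t))"
  proof (rule Bochner_Integration.integral_cong[OF refl])
    fix y
    have "(CLINT t|std_normal_vec. ?g y t) = (CLINT t|std_normal_vec. iexp (((x - y) /\<^sub>R \<sigma>) \<bullet> t))"
      by (simp add: inner_commute)
    then show "of_real (normal_kernel ((x - y) /\<^sub>R \<sigma>)) = of_real ?c * (CLINT t|std_normal_vec. ?g y t)"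
      by (simp only: std_normal_vec_char normal_kernel_eq of_real_mult)
  qed
  also have "\<dots> = of_real ?c * (CLINT y|\<mu>. CLINT t|std_normal_vec. ?g y t)"
    by simp
  also have "(CLINT y|\<mu>. CLINT t|std_normal_vec. ?g y t) = (CLINT t|std_normal_vec. CLINT y|\<mu>. ?g y t)"
  proof (rule Fubini_integral[symmetric])
    show "complex_integrable (\<mu> \<Otimes>\<^sub>M std_normal_vec) (\<lambda>(y, t). ?g y t)"
      by (rule P.integrable_const_bound[where B = 1]) (auto simp: split_beta)
  qed
  also have "\<dots> = (CLINT t|std_normal_vec. iexp (t \<bullet> (x /\<^sub>R \<sigma>)) * (CLINT y|\<mu>. iexp ((- t /\<^sub>R \<sigma>) \<bullet> y)))"
  proof (rule Bochner_Integration.integral_cong[OF refl])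
    fix t :: "real^'n"
    have "?g y t = iexp (t \<bullet> (x /\<^sub>R \<sigma>)) * iexp ((- t /\<^sub>R \<sigma>) \<bullet> y)" for y
      by (simp add: inner_diff_right exp_add[symmetric] algebra_simps)
    then show "(CLINT y|\<mu>. ?g y t) = iexp (t \<bullet> (x /\<^sub>R \<sigma>)) * (CLINT y|\<mu>. iexp ((- t /\<^sub>R \<sigma>) \<bullet> y))"
      by simp
  qed
  finally show ?thesis .
qed

text \<open>
  Adding Gaussian noise of size \<open>\<sigma>\<close> to \<open>\<mu>\<close> yields a law with a density; the substitution
  \<open>x = y + \<sigma> w\<close> and Fubini exhibit it.
\<close>

lemma integral_gauss_smoothing:
  fixes f :: "real^'n \<Rightarrow> real" and \<mu> :: "(real^'n) measure"
  assumes \<mu>: "prob_space \<mu>" "sets \<mu> = sets borel" and s: "0 < (\<sigma>::real)"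
    and f: "integrable lborel f" and [measurable]: "f \<in> borel_measurable borel"
  shows "(\<integral>y. (\<integral>w. f (y + \<sigma> *\<^sub>R w) \<partial>std_normal_vec) \<partial>\<mu>)
     = (1 / \<sigma> ^ CARD('n)) * (\<integral>x. f x * (\<integral>y. normal_kernel ((x - y) /\<^sub>R \<sigma>) \<partial>\<mu>) \<partial>lborel)"
proof -
  interpret \<mu>: prob_space \<mu> by fact
  interpret pair_sigma_finite \<mu> "lborel :: (real^'n) measure" ..
  note [measurable_cong] = \<mu>(2)
  define C where "C = (1 / sqrt (2 * pi)) ^ CARD('n)"
  have k_le: "normal_kernel z \<le> C" for z :: "real^'n"
    unfolding C_def by (rule normal_kernel_le)
  have inner: "(\<integral>w. f (y + \<sigma> *\<^sub>R w) \<partial>std_normal_vec) = (1 / \<sigma> ^ CARD('n)) * (\<integral>x. f x * normal_kernel ((x - y) /\<^sub>R \<sigma>) \<partial>lborel)" for y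
  proof -
    have "(\<integral>x. f x * normal_kernel ((x - y) /\<^sub>R \<sigma>) \<partial>lborel)
       = (\<integral>x. f x * normal_kernel ((x - y) /\<^sub>R \<sigma>) \<partial>density (distr lborel borel (\<lambda>w. y + \<sigma> *\<^sub>R w)) (\<lambda>_. ennreal (\<bar>\<sigma>\<bar> ^ DIM(real^'n))))"
      using lborel_affine[of \<sigma> y] s by simp
    also have "\<dots> = \<sigma> ^ CARD('n) * (\<integral>w. f (y + \<sigma> *\<^sub>R w) * normal_kernel w \<partial>lborel)"
      using s by (subst integral_density) (auto simp: integral_distr)
    finally have "(\<integral>w. f (y + \<sigma> *\<^sub>R w) * normal_kernel w \<partial>lborel) = (1 / \<sigma> ^ CARD('n)) * (\<integral>x. f x * normal_kernel ((x - y) /\<^sub>R \<sigma>) \<partial>lborel)"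
      using s by simp
    moreover have "(\<integral>w. f (y + \<sigma> *\<^sub>R w) \<partial>std_normal_vec) = (\<integral>w. f (y + \<sigma> *\<^sub>R w) * normal_kernel w \<partial>lborel)"
      by (subst integral_std_normal_vec) (auto simp: mult.commute)
    ultimately show ?thesis by simp
  qed
  have int: "integrable (\<mu> \<Otimes>\<^sub>M lborel) (\<lambda>(y, x). f x * normal_kernel ((x - y) /\<^sub>R \<sigma>))"
  proof (rule Bochner_Integration.integrable_bound)
    show "integrable (\<mu> \<Otimes>\<^sub>M lborel) (\<lambda>(y, x). f x * C)"
    proof (rule Fubini_integrable)
      show "integrable \<mu> (\<lambda>y. \<integral>x. norm (case (y, x) of (y, x) \<Rightarrow> f x * C) \<partial>lborel)" by simp
      show "AE y in \<mu>. integrable lborel (\<lambda>x. case (y, x) of (y, x) \<Rightarrow> f x * C)" using f by simp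
    qed measurable
    show "AE z in \<mu> \<Otimes>\<^sub>M lborel. norm (case z of (y, x) \<Rightarrow> f x * normal_kernel ((x - y) /\<^sub>R \<sigma>)) \<le> norm (case z of (y, x) \<Rightarrow> f x * C)"
    proof (intro AE_I2, clarify)
      fix y x :: "real^'n"
      have "normal_kernel ((x - y) /\<^sub>R \<sigma>) \<le> \<bar>C\<bar>"
        using k_le[of "(x - y) /\<^sub>R \<sigma>"] by linarith
      then show "norm (f x * normal_kernel ((x - y) /\<^sub>R \<sigma>)) \<le> norm (f x * C)"
        by (simp add: abs_mult normal_kernel_nonneg mult_left_mono)
    qed
  qed measurable
  have "(\<integral>y. (\<integral>w. f (y + \<sigma> *\<^sub>R w) \<partial>std_normal_vec) \<partial>\<mu>)
      = (1 / \<sigma> ^ CARD('n)) * (\<integral>y. (\<integral>x. f x * normal_kernel ((x - y) /\<^sub>R \<sigma>) \<partial>lborel) \<partial>\<mu>)"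
    unfolding inner by simp
  also have "(\<integral>y. (\<integral>x. f x * normal_kernel ((x - y) /\<^sub>R \<sigma>) \<partial>lborel) \<partial>\<mu>)
      = (\<integral>x. (\<integral>y. f x * normal_kernel ((x - y) /\<^sub>R \<sigma>) \<partial>\<mu>) \<partial>lborel)"
    by (rule Fubini_integral[symmetric, OF int])
  also have "\<dots> = (\<integral>x. f x * (\<integral>y. normal_kernel ((x - y) /\<^sub>R \<sigma>) \<partial>\<mu>) \<partial>lborel)"
    by simp
  finally show ?thesis .
qed

text \<open>
  Uniform continuity on a ball one unit larger than the support is enough: two points at distance
  below 1 lie both in that ball or both outside the support.
\<close>

lemma compact_support_uniformly_continuous:
  fixes f :: "real^'n \<Rightarrow> real"
  assumes f: "continuous_on UNIV f" and supp: "\<And>x. R < norm x \<Longrightarrow> f x = 0"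
  shows "uniformly_continuous_on UNIV f"
  unfolding uniformly_continuous_on_def ball_UNIV
proof (intro allI impI)
  fix e :: real assume e: "0 < e"
  have "uniformly_continuous_on (cball 0 (R + 1)) f"
    by (intro compact_uniformly_continuous continuous_on_subset[OF f]) auto
  then obtain d where d: "0 < d" "\<And>x x'. x \<in> cball 0 (R + 1) \<Longrightarrow> x' \<in> cball 0 (R + 1) \<Longrightarrow> dist x' x < d \<Longrightarrow> dist (f x') (f x) < e"
    using e by (auto simp: uniformly_continuous_on_def) 
  show "\<exists>d>0. \<forall>x x'. dist x' x < d \<longrightarrow> dist (f x') (f x) < e"
  proof (intro exI[of _ "min d 1"] conjI allI impI)
    fix x' x :: "real^'n" assume xx: "dist x x' < min d 1"
    have tri: "norm x \<le> norm x' + dist x x'" "norm x' \<le> norm x + dist x x'"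
      using norm_triangle_ineq2[of x x'] norm_triangle_ineq2[of x' x] by (simp_all add: dist_norm norm_minus_commute)
    show "dist (f x) (f x') < e"
    proof (cases "norm x \<le> R \<or> norm x' \<le> R")
      case True
      then have "x \<in> cball 0 (R + 1)" "x' \<in> cball 0 (R + 1)" using tri xx by auto
      then show ?thesis using d(2)[of x' x] xx by auto
    next
      case False
      then show ?thesis using supp[of x] supp[of x'] e by auto
    qed
  qed (use d in auto)
qed

text \<open>
  The hypothesis of Levy's continuity theorem in \<open>real ^ 'n\<close>: laws whose characteristic functions
  converge pointwise to that of a probability law \<open>L\<close>. The conclusion is reached through test functions
  of increasing generality.
\<close>

locale char_convergence =
  fixes \<mu> :: "nat \<Rightarrow> (real^'n) measure" and L :: "(real^'n) measure"
  assumes prob_mu: "prob_space (\<mu> n)" and sets_mu: "sets (\<mu> n) = sets borel"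
    and prob_L: "prob_space L" and sets_L: "sets L = sets borel"
    and char_conv: "(\<lambda>n. CLINT x|\<mu> n. iexp (t \<bullet> x)) \<longlonglongrightarrow> (CLINT x|L. iexp (t \<bullet> x))"
begin

text \<open>
  Characteristic functions are bounded by 1, so dominated convergence applies under the Gaussian
  average.
\<close>

lemma smoothed_density_tendsto:
  assumes s: "0 < (\<sigma>::real)"
  shows "(\<lambda>n. \<integral>y. normal_kernel ((x - y) /\<^sub>R \<sigma>) \<partial>\<mu> n) \<longlonglongrightarrow> (\<integral>y. normal_kernel ((x - y) /\<^sub>R \<sigma>) \<partial>L)"
proof -
  have char_le: "cmod (CLINT y|M. iexp (u \<bullet> y)) \<le> 1" if "prob_space M" "sets M = sets borel" for M and u :: "real^'n"
  proof -
    interpret prob_space M by fact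
    have "cmod (CLINT y|M. iexp (u \<bullet> y)) \<le> (\<integral>y. cmod (iexp (u \<bullet> y)) \<partial>M)"
      by (rule integral_norm_bound)
    then show ?thesis by (simp add: prob_space)
  qed
  have meas: "(\<lambda>t. CLINT y|M. iexp ((- t /\<^sub>R \<sigma>) \<bullet> y)) \<in> borel_measurable borel"
    if "prob_space M" "sets M = sets borel" for M :: "(real^'n) measure"
  proof -
    interpret prob_space M by fact
    note [measurable_cong] = that(2)
    show ?thesis by measurable
  qed
  have "(\<lambda>n. CLINT t|std_normal_vec. iexp (t \<bullet> (x /\<^sub>R \<sigma>)) * (CLINT y|\<mu> n. iexp ((- t /\<^sub>R \<sigma>) \<bullet> y)))
     \<longlonglongrightarrow> (CLINT t|std_normal_vec. iexp (t \<bullet> (x /\<^sub>R \<sigma>)) * (CLINT y|L. iexp ((- t /\<^sub>R \<sigma>) \<bullet> y)))"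
  proof (rule integral_dominated_convergence[where w = "\<lambda>_. 1"])
    show "AE t in std_normal_vec. (\<lambda>n. iexp (t \<bullet> (x /\<^sub>R \<sigma>)) * (CLINT y|\<mu> n. iexp ((- t /\<^sub>R \<sigma>) \<bullet> y)))
        \<longlonglongrightarrow> iexp (t \<bullet> (x /\<^sub>R \<sigma>)) * (CLINT y|L. iexp ((- t /\<^sub>R \<sigma>) \<bullet> y))"
      by (intro AE_I2 tendsto_mult tendsto_const char_conv)
    show "AE t in std_normal_vec. cmod (iexp (t \<bullet> (x /\<^sub>R \<sigma>)) * (CLINT y|\<mu> n. iexp ((- t /\<^sub>R \<sigma>) \<bullet> y))) \<le> 1" for n
      using char_le[OF prob_mu sets_mu] by (intro AE_I2) (simp only: norm_mult norm_exp_i_times mult_1)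
  next
    have *: "(\<lambda>t. iexp (t \<bullet> (x /\<^sub>R \<sigma>)) * (CLINT y|M. iexp ((- t /\<^sub>R \<sigma>) \<bullet> y))) \<in> borel_measurable std_normal_vec"
      if "prob_space M" "sets M = sets borel" for M
    proof -
      note [measurable] = meas[OF that]
      show ?thesis by measurable
    qed
    show "(\<lambda>t. iexp (t \<bullet> (x /\<^sub>R \<sigma>)) * (CLINT y|L. iexp ((- t /\<^sub>R \<sigma>) \<bullet> y))) \<in> borel_measurable std_normal_vec"
      by (rule *[OF prob_L sets_L])
    show "(\<lambda>t. iexp (t \<bullet> (x /\<^sub>R \<sigma>)) * (CLINT y|\<mu> n. iexp ((- t /\<^sub>R \<sigma>) \<bullet> y))) \<in> borel_measurable std_normal_vec" for n
      by (rule *[OF prob_mu sets_mu])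
  qed simp
  then have "(\<lambda>n. complex_of_real (\<integral>y. normal_kernel ((x - y) /\<^sub>R \<sigma>) \<partial>\<mu> n))
      \<longlonglongrightarrow> complex_of_real (\<integral>y. normal_kernel ((x - y) /\<^sub>R \<sigma>) \<partial>L)"
    unfolding smoothed_density_eq[OF prob_mu sets_mu s] smoothed_density_eq[OF prob_L sets_L s]
    by (intro tendsto_mult tendsto_const)
  then show ?thesis by (simp only: tendsto_of_real_iff)
qed

lemma smoothed_tendsto:
  fixes f :: "real^'n \<Rightarrow> real"
  assumes f: "integrable lborel f" and fm[measurable]: "f \<in> borel_measurable borel" and s: "0 < (\<sigma>::real)"
  shows "(\<lambda>n. \<integral>y. (\<integral>w. f (y + \<sigma> *\<^sub>R w) \<partial>std_normal_vec) \<partial>\<mu> n)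
     \<longlonglongrightarrow> (\<integral>y. (\<integral>w. f (y + \<sigma> *\<^sub>R w) \<partial>std_normal_vec) \<partial>L)"
proof -
  define C where "C = (1 / sqrt (2 * pi)) ^ CARD('n)"
  have k_le: "normal_kernel z \<le> C" for z :: "real^'n"
    unfolding C_def by (rule normal_kernel_le)
  have q_meas: "(\<lambda>x. \<integral>y. normal_kernel ((x - y) /\<^sub>R \<sigma>) \<partial>M) \<in> borel_measurable borel"
    if "prob_space M" "sets M = sets borel" for M :: "(real^'n) measure"
  proof -
    interpret prob_space M by fact
    note [measurable_cong] = that(2)
    show ?thesis by measurable
  qed
  have q_le: "\<bar>\<integral>y. normal_kernel ((x - y) /\<^sub>R \<sigma>) \<partial>M\<bar> \<le> C" if "prob_space M" "sets M = sets borel" for M and x :: "real^'n"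
  proof -
    interpret prob_space M by fact
    note [measurable_cong] = that(2)
    have "integrable M (\<lambda>y. normal_kernel ((x - y) /\<^sub>R \<sigma>))"
      by (rule integrable_const_bound[where B = C]) (auto simp: k_le normal_kernel_nonneg)
    then have "(\<integral>y. normal_kernel ((x - y) /\<^sub>R \<sigma>) \<partial>M) \<le> (\<integral>y. C \<partial>M)"
      by (rule integral_mono) (auto simp: k_le)
    moreover have "0 \<le> (\<integral>y. normal_kernel ((x - y) /\<^sub>R \<sigma>) \<partial>M)"
      by (rule integral_nonneg_AE) (simp add: normal_kernel_nonneg)
    ultimately show ?thesis by (simp add: prob_space)
  qed
  have "(\<lambda>n. \<integral>x. f x * (\<integral>y. normal_kernel ((x - y) /\<^sub>R \<sigma>) \<partial>\<mu> n) \<partial>lborel)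
      \<longlonglongrightarrow> (\<integral>x. f x * (\<integral>y. normal_kernel ((x - y) /\<^sub>R \<sigma>) \<partial>L) \<partial>lborel)"
  proof (rule integral_dominated_convergence[where w = "\<lambda>x. \<bar>f x\<bar> * C"])
    show "AE x in lborel. (\<lambda>n. f x * (\<integral>y. normal_kernel ((x - y) /\<^sub>R \<sigma>) \<partial>\<mu> n))
        \<longlonglongrightarrow> f x * (\<integral>y. normal_kernel ((x - y) /\<^sub>R \<sigma>) \<partial>L)"
      by (intro AE_I2 tendsto_mult tendsto_const smoothed_density_tendsto s)
    show "AE x in lborel. norm (f x * (\<integral>y. normal_kernel ((x - y) /\<^sub>R \<sigma>) \<partial>\<mu> n)) \<le> \<bar>f x\<bar> * C" for n
      using q_le[OF prob_mu sets_mu] by (auto simp: abs_mult intro!: mult_left_mono)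
  qed (use f in \<open>auto intro!: borel_measurable_times q_meas prob_mu sets_mu prob_L sets_L\<close>)
  then show ?thesis
    unfolding integral_gauss_smoothing[OF prob_mu sets_mu s f fm] integral_gauss_smoothing[OF prob_L sets_L s f fm]
    by (intro tendsto_mult tendsto_const)
qed

text \<open>
  A uniformly continuous function barely changes when its argument is perturbed by Gaussian noise
  of small size \<open>\<sigma>\<close>, uniformly in the argument. Replacing \<open>f\<close> by its average over the noise therefore
  costs little under every law, and for these averages convergence is known.
\<close>

lemma compact_support_tendsto:
  fixes f :: "real^'n \<Rightarrow> real"
  assumes f: "continuous_on UNIV f" and supp: "\<And>x. R < norm x \<Longrightarrow> f x = 0"
  shows "(\<lambda>n. \<integral>y. f y \<partial>\<mu> n) \<longlonglongrightarrow> (\<integral>y. f y \<partial>L)"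
proof -
  have fm[measurable]: "f \<in> borel_measurable borel"
    using f by (rule borel_measurable_continuous_onI)
  have "bounded (f ` cball 0 R)"
    by (intro compact_imp_bounded compact_continuous_image continuous_on_subset[OF f]) auto
  then obtain B0 where B0: "\<And>x. x \<in> cball 0 R \<Longrightarrow> \<bar>f x\<bar> \<le> B0"
    unfolding bounded_iff by (metis image_eqI real_norm_def)
  define B where "B = max B0 0"
  have B: "\<bar>f x\<bar> \<le> B" for x
    using B0[of x] supp[of x] by (cases "norm x \<le> R") (auto simp: B_def)
  have B_nonneg: "0 \<le> B" by (simp add: B_def)
  have int_f: "integrable lborel f"
  proof -
    have "integrable lborel (\<lambda>x. indicator (cball 0 R) x *\<^sub>R f x)"
      by (rule borel_integrable_compact) (auto intro: continuous_on_subset[OF f])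
    also have "(\<lambda>x. indicator (cball 0 R) x *\<^sub>R f x) = f"
      using supp by (auto simp: indicator_def fun_eq_iff)
    finally show ?thesis .
  qed
  have int_bdd: "integrable M g" if "prob_space M" "sets M = sets borel" "g \<in> borel_measurable borel" "\<And>x. \<bar>g x\<bar> \<le> B"
    for M and g :: "real^'n \<Rightarrow> real"
  proof -
    interpret prob_space M by fact
    show ?thesis
      using that by (intro integrable_const_bound[where B = B]) (auto cong: measurable_cong_sets)
  qed
  define V where "V = (\<integral>w. (norm (w :: real^'n))\<^sup>2 \<partial>std_normal_vec)"
  let ?A = "\<lambda>\<sigma> y. \<integral>w. f (y + \<sigma> *\<^sub>R w) \<partial>std_normal_vec"
  have A_meas[measurable]: "?A \<sigma> \<in> borel_measurable borel" for \<sigma> :: real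
    by measurable
  have intA: "integrable std_normal_vec (\<lambda>w. f (y + \<sigma> *\<^sub>R w))" for y and \<sigma> :: real
    by (rule int_bdd[OF prob_space_std_normal_vec sets_std_normal_vec]) (auto simp: B)
  have A_le: "\<bar>?A \<sigma> y\<bar> \<le> B" for \<sigma> :: real and y
  proof -
    have "\<bar>?A \<sigma> y\<bar> \<le> (\<integral>w. \<bar>f (y + \<sigma> *\<^sub>R w)\<bar> \<partial>std_normal_vec)"
      using integral_norm_bound[of std_normal_vec "\<lambda>w. f (y + \<sigma> *\<^sub>R w)"] by simp
    also have "\<dots> \<le> (\<integral>w. B \<partial>(std_normal_vec :: (real^'n) measure))"
      using intA[of y \<sigma>] by (intro integral_mono) (auto simp: B)
    finally show ?thesis by (simp add: std_normal_vec.prob_space)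
  qed
  have unif: "uniformly_continuous_on UNIV f"
    using f supp by (rule compact_support_uniformly_continuous)
  have approx: "\<exists>\<sigma>>0. \<forall>y. \<bar>?A \<sigma> y - f y\<bar> \<le> e" if e: "0 < e" for e :: real
  proof -
    obtain d where d: "0 < d" "\<And>x x'. dist x x' < d \<Longrightarrow> dist (f x) (f x') < e / 2"
      using unif e unfolding uniformly_continuous_on_def by (metis UNIV_I half_gt_zero)
    \<comment> \<open>A quadratic modulus of continuity: its Gaussian average involves only the second moment.\<close>
    have mod: "\<bar>f u - f v\<bar> \<le> e / 2 + 2 * B / d\<^sup>2 * (norm (u - v))\<^sup>2" for u v
    proof (cases "dist u v < d")
      case True
      have "\<bar>f u - f v\<bar> < e / 2" using d(2)[OF True] by (simp add: dist_real_def)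
      moreover have "0 \<le> 2 * B / d\<^sup>2 * (norm (u - v))\<^sup>2" using B_nonneg by simp
      ultimately show ?thesis by linarith
    next
      case False
      then have "d\<^sup>2 \<le> (norm (u - v))\<^sup>2" using d(1) by (intro power_mono) (auto simp: dist_norm)
      then have "2 * B * 1 \<le> 2 * B * ((norm (u - v))\<^sup>2 / d\<^sup>2)"
        using d(1) B_nonneg by (intro mult_left_mono) auto
      moreover have "\<bar>f u - f v\<bar> \<le> 2 * B" using B[of u] B[of v] by linarith
      ultimately show ?thesis using e by simp
    qed
    have V_nonneg: "0 \<le> V" by (simp add: V_def)
    \<comment> \<open>\<open>\<sigma>\<^sup>2 D\<close> is the expected cost of the quadratic term, so \<open>\<sigma>\<close> is chosen to make it at most \<open>e / 2\<close>.\<close>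
    define D where "D = 2 * B / d\<^sup>2 * V"
    define \<sigma> where "\<sigma> = sqrt (e / (2 * (D + 1)))"
    have D: "0 \<le> D" using B_nonneg V_nonneg by (simp add: D_def)
    have s: "0 < \<sigma>" using e D by (simp add: \<sigma>_def)
    have s2: "\<sigma>\<^sup>2 = e / (2 * (D + 1))" using e D by (simp add: \<sigma>_def)
    have le: "\<sigma>\<^sup>2 * D \<le> e / 2"
    proof -
      have "\<sigma>\<^sup>2 * D \<le> \<sigma>\<^sup>2 * (D + 1)" by (intro mult_left_mono) auto
      also have "\<dots> = e / 2" using D unfolding s2 by (simp add: field_simps)
      finally show ?thesis .
    qed
    have bnd: "\<bar>?A \<sigma> y - f y\<bar> \<le> e / 2 + \<sigma>\<^sup>2 * D" for y
    proof -
      have "?A \<sigma> y - f y = (\<integral>w. f (y + \<sigma> *\<^sub>R w) - f y \<partial>std_normal_vec)"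
        using intA by (simp add: std_normal_vec.prob_space)
      also have "\<bar>\<dots>\<bar> \<le> (\<integral>w. \<bar>f (y + \<sigma> *\<^sub>R w) - f y\<bar> \<partial>std_normal_vec)"
        using integral_norm_bound[of std_normal_vec "\<lambda>w. f (y + \<sigma> *\<^sub>R w) - f y"] by simp
      also have "\<dots> \<le> (\<integral>w. e / 2 + 2 * B / d\<^sup>2 * \<sigma>\<^sup>2 * (norm (w :: real^'n))\<^sup>2 \<partial>std_normal_vec)"
      proof (rule integral_mono)
        show "integrable std_normal_vec (\<lambda>w. \<bar>f (y + \<sigma> *\<^sub>R w) - f y\<bar>)"
          using intA by auto
        show "integrable std_normal_vec (\<lambda>w::real^'n. e / 2 + 2 * B / d\<^sup>2 * \<sigma>\<^sup>2 * (norm w)\<^sup>2)"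
          by (intro Bochner_Integration.integrable_add std_normal_vec.integrable_const
              integrable_mult_right std_normal_vec_second_moment)
        fix w :: "real^'n"
        show "\<bar>f (y + \<sigma> *\<^sub>R w) - f y\<bar> \<le> e / 2 + 2 * B / d\<^sup>2 * \<sigma>\<^sup>2 * (norm w)\<^sup>2"
          using mod[of "y + \<sigma> *\<^sub>R w" y] by (simp add: power_mult_distrib mult_ac)
      qed
      also have "\<dots> = e / 2 + \<sigma>\<^sup>2 * D"
        using std_normal_vec_second_moment[where 'n='n]
        by (simp add: std_normal_vec.prob_space V_def D_def)
      finally show ?thesis .
    qed
    have "\<bar>?A \<sigma> y - f y\<bar> \<le> e" for y using bnd[of y] le by linarith
    then show ?thesis using s by blast
  qed
  show ?thesis
  proof (rule LIMSEQ_I)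
    fix e :: real assume e: "0 < e"
    then obtain \<sigma> where s: "0 < \<sigma>" "\<And>y. \<bar>?A \<sigma> y - f y\<bar> \<le> e / 4"
      using approx[of "e / 4"] by auto
    obtain n0 where n0: "\<And>n. n \<ge> n0 \<Longrightarrow> \<bar>(\<integral>y. ?A \<sigma> y \<partial>\<mu> n) - (\<integral>y. ?A \<sigma> y \<partial>L)\<bar> < e / 4"
      using LIMSEQ_D[OF smoothed_tendsto[OF int_f fm s(1)], of "e / 4"] e by auto
    have close: "\<bar>(\<integral>y. ?A \<sigma> y \<partial>M) - (\<integral>y. f y \<partial>M)\<bar> \<le> e / 4" if M: "prob_space M" "sets M = sets borel" for M
    proof -
      interpret prob_space M by fact
      have i: "integrable M (?A \<sigma>)" "integrable M f"
        using A_le B by (auto intro!: int_bdd M)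
      have "(\<integral>y. ?A \<sigma> y \<partial>M) - (\<integral>y. f y \<partial>M) = (\<integral>y. ?A \<sigma> y - f y \<partial>M)"
        using i by simp
      also have "\<bar>\<dots>\<bar> \<le> (\<integral>y. \<bar>?A \<sigma> y - f y\<bar> \<partial>M)"
        using integral_norm_bound[of M "\<lambda>y. ?A \<sigma> y - f y"] by simp
      also have "\<dots> \<le> (\<integral>y. e / 4 \<partial>M)"
        using i s(2) by (intro integral_mono) auto
      finally show ?thesis by (simp add: prob_space)
    qed
    show "\<exists>n0. \<forall>n\<ge>n0. norm ((\<integral>y. f y \<partial>\<mu> n) - (\<integral>y. f y \<partial>L)) < e"
    proof (intro exI[of _ n0] allI impI)
      fix n assume "n0 \<le> n"
      then show "norm ((\<integral>y. f y \<partial>\<mu> n) - (\<integral>y. f y \<partial>L)) < e"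
        using n0[of n] close[OF prob_mu[of n] sets_mu[of n]] close[OF prob_L sets_L] e
        unfolding real_norm_def by linarith
    qed
  qed
qed

text \<open>
  Multiply \<open>f\<close> by a continuous cutoff. What is lost is at most a bound of \<open>f\<close> times the mass that the
  cutoff misses; under \<open>L\<close> this is small, and it stays small under the laws \<open>\<mu> n\<close> because the cutoff is
  itself a test function of compact support.
\<close>

proposition bounded_continuous_tendsto:
  fixes f :: "real^'n \<Rightarrow> real"
  assumes f: "continuous_on UNIV f" and bdd: "bounded (range f)"
  shows "(\<lambda>n. \<integral>y. f y \<partial>\<mu> n) \<longlonglongrightarrow> (\<integral>y. f y \<partial>L)"
proof -
  obtain B0 where "\<And>x. \<bar>f x\<bar> \<le> B0"
    using bdd by (auto simp: bounded_iff)
  then obtain B where B: "\<And>x. \<bar>f x\<bar> \<le> B" "0 < B"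
    by (metis abs_ge_zero dual_order.trans gt_ex less_eq_real_def order_less_trans)
  define cut where "cut m x = max 0 (min 1 (real m + 1 - norm x))" for m and x :: "real^'n"
  have chi: "0 \<le> cut m x" "cut m x \<le> 1" for m and x :: "real^'n" by (auto simp: cut_def)
  have chi_cont: "continuous_on UNIV (cut m)" for m
    unfolding cut_def by (intro continuous_intros)
  have chi_supp: "cut m x = 0" if "real m + 1 < norm x" for m and x :: "real^'n"
    using that by (simp add: cut_def)
  have [measurable]: "f \<in> borel_measurable borel" "cut m \<in> borel_measurable borel" for m
    by (intro borel_measurable_continuous_onI f chi_cont)+
  interpret L: prob_space L by (rule prob_L)
  note [measurable_cong] = sets_L sets_mu
  have "(\<lambda>m. \<integral>x. cut m x \<partial>L) \<longlonglongrightarrow> (\<integral>x. 1 \<partial>L)"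
  proof (rule integral_dominated_convergence[where w = "\<lambda>_. 1"])
    show "AE x in L. (\<lambda>m. cut m x) \<longlonglongrightarrow> 1"
    proof (rule AE_I2)
      fix x :: "real^'n"
      obtain m0 :: nat where "norm x \<le> real m0" using real_arch_simple by blast
      then have "\<forall>\<^sub>F m in sequentially. cut m x = 1"
        by (intro eventually_sequentiallyI[of m0]) (auto simp: cut_def)
      then show "(\<lambda>m. cut m x) \<longlonglongrightarrow> 1" by (rule tendsto_eventually)
    qed
  qed (auto simp: chi)
  then have chi_lim: "(\<lambda>m. \<integral>x. cut m x \<partial>L) \<longlonglongrightarrow> 1" by (simp add: L.prob_space)
  have split: "\<bar>(\<integral>x. f x \<partial>M) - (\<integral>x. f x * cut m x \<partial>M)\<bar> \<le> B * (1 - (\<integral>x. cut m x \<partial>M))"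
    if M: "prob_space M" "sets M = sets borel" for M :: "(real^'n) measure" and m
  proof -
    interpret prob_space M by fact
    note [measurable_cong] = M(2)
    have i: "integrable M f" "integrable M (\<lambda>x. f x * cut m x)" "integrable M (cut m)"
    proof -
      show "integrable M f" by (rule integrable_const_bound[where B = B]) (auto simp: B)
      show "integrable M (cut m)" by (rule integrable_const_bound[where B = 1]) (auto simp: chi)
      have "\<bar>f x\<bar> * \<bar>cut m x\<bar> \<le> B * 1" for x using B chi[of m x] by (intro mult_mono) auto
      then show "integrable M (\<lambda>x. f x * cut m x)" by (intro integrable_const_bound[where B = B]) (auto simp: abs_mult)
    qed
    have "(\<integral>x. f x \<partial>M) - (\<integral>x. f x * cut m x \<partial>M) = (\<integral>x. f x - f x * cut m x \<partial>M)"
      using i by simp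
    also have "\<bar>\<dots>\<bar> \<le> (\<integral>x. \<bar>f x - f x * cut m x\<bar> \<partial>M)"
      using integral_norm_bound[of M "\<lambda>x. f x - f x * cut m x"] by simp
    also have "\<dots> \<le> (\<integral>x. B * (1 - cut m x) \<partial>M)"
    proof (rule integral_mono)
      fix x
      have "f x - f x * cut m x = f x * (1 - cut m x)" by (simp add: algebra_simps)
      then show "\<bar>f x - f x * cut m x\<bar> \<le> B * (1 - cut m x)"
        using B(1)[of x] chi[of m x] by (simp add: abs_mult mult_right_mono)
    qed (use i in auto)
    also have "\<dots> = B * (1 - (\<integral>x. cut m x \<partial>M))"
      using i by (simp add: prob_space)
    finally show ?thesis .
  qed
  show ?thesis
  proof (rule LIMSEQ_I)
    fix e :: real assume e: "0 < e"
    define \<eta> where "\<eta> = e / (6 * B)"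
    have eta: "0 < \<eta>" "B * \<eta> = e / 6" using e B(2) by (auto simp: \<eta>_def)
    obtain m where m: "\<bar>(\<integral>x. cut m x \<partial>L) - 1\<bar> < \<eta>"
      using LIMSEQ_D[OF chi_lim eta(1)] by auto
    have fchi: "(\<lambda>n. \<integral>y. f y * cut m y \<partial>\<mu> n) \<longlonglongrightarrow> (\<integral>y. f y * cut m y \<partial>L)"
      by (rule compact_support_tendsto[where R = "real m + 1"])
        (auto intro!: continuous_on_mult f chi_cont simp: chi_supp)
    have chi_conv: "(\<lambda>n. \<integral>y. cut m y \<partial>\<mu> n) \<longlonglongrightarrow> (\<integral>y. cut m y \<partial>L)"
      by (rule compact_support_tendsto[where R = "real m + 1"]) (auto intro!: chi_cont simp: chi_supp)
    obtain n1 where n1: "\<And>n. n \<ge> n1 \<Longrightarrow> \<bar>(\<integral>y. f y * cut m y \<partial>\<mu> n) - (\<integral>y. f y * cut m y \<partial>L)\<bar> < e / 6"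
      using LIMSEQ_D[OF fchi, of "e / 6"] e by auto
    obtain n2 where n2: "\<And>n. n \<ge> n2 \<Longrightarrow> \<bar>(\<integral>y. cut m y \<partial>\<mu> n) - (\<integral>y. cut m y \<partial>L)\<bar> < \<eta>"
      using LIMSEQ_D[OF chi_conv eta(1)] by auto
    show "\<exists>n0. \<forall>n\<ge>n0. norm ((\<integral>y. f y \<partial>\<mu> n) - (\<integral>y. f y \<partial>L)) < e"
    proof (intro exI[of _ "max n1 n2"] allI impI)
      fix n assume n: "max n1 n2 \<le> n"
      have a: "B * (1 - (\<integral>x. cut m x \<partial>L)) \<le> B * \<eta>"
        using m B(2) by (intro mult_left_mono) auto
      have b: "B * (1 - (\<integral>x. cut m x \<partial>\<mu> n)) \<le> B * (2 * \<eta>)"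
        using m n2[of n] n B(2) by (intro mult_left_mono) auto
      have "B * (2 * \<eta>) = e / 3" using eta(2) by simp
      then show "norm ((\<integral>y. f y \<partial>\<mu> n) - (\<integral>y. f y \<partial>L)) < e"
        using a b eta(2) n1[of n] n split[OF prob_mu[of n] sets_mu[of n], of m] split[OF prob_L sets_L, of m] e
        unfolding real_norm_def by linarith
    qed
  qed
qed

end

section \<open>Projections on nearly orthonormal vectors\<close>

lemma borel_measurable_vec_lambda [measurable (raw)]:
  fixes g :: "'a \<Rightarrow> 'n::finite \<Rightarrow> real"
  assumes "\<And>i. (\<lambda>x. g x i) \<in> borel_measurable M"
  shows "(\<lambda>x. \<chi> i. g x i) \<in> borel_measurable M"
  using assms by (subst borel_measurable_euclidean_space) (auto simp: Basis_vec_def inner_axis)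

text \<open>
  The factor \<open>sqrt d\<close> compensates the variance \<open>1/d\<close> of the inner product of a uniform direction with a
  unit vector.
\<close>

definition projections :: "nat \<Rightarrow> ('n::finite \<Rightarrow> nat \<Rightarrow> real) \<Rightarrow> (nat \<Rightarrow> real) \<Rightarrow> real ^ 'n" where
  "projections d u v = (\<chi> i. sqrt (real d) * inner_vec d v (u i))"

lemma projections_measurable [measurable]: "projections d u \<in> borel_measurable (borel_vec d)"
  unfolding projections_def[abs_def] by measurable

lemma sets_unif_sphere [measurable_cong]: "sets (unif_sphere d) = sets (borel_vec d)"
  by (simp add: unif_sphere_def)

text \<open>
  A linear combination of the projections on the \<open>u i\<close> is one projection, on the combined vector.
  This is the Cramer-Wold step: it reduces the joint characteristic function to a single linear form.
\<close>

lemma inner_projections: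
  "t \<bullet> projections d u v = sqrt (real d) * inner_vec d v (\<lambda>k. \<Sum>i\<in>UNIV. t $ i * u i k)"
proof -
  have "t \<bullet> projections d u v = (\<Sum>i\<in>UNIV. \<Sum>k<d. sqrt (real d) * (v k * (t $ i * u i k)))"
    by (simp add: inner_vec_def projections_def sum_distrib_left mult_ac)
  also have "\<dots> = (\<Sum>k<d. \<Sum>i\<in>UNIV. sqrt (real d) * (v k * (t $ i * u i k)))"
    by (rule sum.swap)
  finally show ?thesis by (simp add: sum_distrib_left)
qed

lemma sum_square_combination:
  "(\<Sum>k<d. (\<Sum>i\<in>UNIV. t $ i * u i k)\<^sup>2) = (\<Sum>i\<in>UNIV. \<Sum>j\<in>UNIV. t $ i * t $ j * inner_vec d (u i) (u j))"
  for t :: "real ^ 'n"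
proof -
  have "(\<Sum>k<d. (\<Sum>i\<in>UNIV. t $ i * u i k)\<^sup>2) = (\<Sum>k<d. \<Sum>i\<in>UNIV. \<Sum>j\<in>UNIV. t $ i * t $ j * (u i k * u j k))"
    by (simp add: power2_eq_square sum_product mult_ac)
  also have "\<dots> = (\<Sum>i\<in>UNIV. \<Sum>k<d. \<Sum>j\<in>UNIV. t $ i * t $ j * (u i k * u j k))"
    by (rule sum.swap)
  also have "\<dots> = (\<Sum>i\<in>UNIV. \<Sum>j\<in>UNIV. \<Sum>k<d. t $ i * t $ j * (u i k * u j k))"
    by (intro sum.cong refl sum.swap)
  finally show ?thesis by (simp add: sum_distrib_left)
qed

text \<open>
  The characteristic function at \<open>t\<close> is within \<open>O(1 / sqrt d)\<close> of \<open>exp (- q / 2)\<close>, where \<open>q\<close> is the Gram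
  form of the vectors \<open>u i\<close> at \<open>t\<close>; if the Gram matrix tends to the identity, \<open>q\<close> tends to \<open>\<parallel>t\<parallel>\<^sup>2\<close>.
\<close>

lemma projections_clt_sequence:
  fixes u :: "nat \<Rightarrow> 'n::finite \<Rightarrow> nat \<Rightarrow> real" and D :: "nat \<Rightarrow> nat" and f :: "real ^ 'n \<Rightarrow> real"
  assumes D: "\<And>n. D n \<ge> 1" "filterlim D at_top sequentially"
    and gram: "\<And>i j. (\<lambda>n. inner_vec (D n) (u n i) (u n j)) \<longlonglongrightarrow> (if i = j then 1 else 0)"
    and f: "continuous_on UNIV f" "bounded (range f)"
  shows "(\<lambda>n. \<integral>v. f (projections (D n) (u n) v) \<partial>unif_sphere (D n)) \<longlonglongrightarrow> (\<integral>z. f z \<partial>std_normal_vec)"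
proof -
  have [measurable]: "f \<in> borel_measurable borel"
    using f(1) by (rule borel_measurable_continuous_onI)
  define \<mu> where "\<mu> n = distr (unif_sphere (D n)) borel (projections (D n) (u n))" for n
  have int_mu: "(\<integral>z. g z \<partial>\<mu> n) = (\<integral>v. g (projections (D n) (u n) v) \<partial>unif_sphere (D n))"
    if "g \<in> borel_measurable borel" for g :: "real^'n \<Rightarrow> 'b::{banach, second_countable_topology}" and n
    unfolding \<mu>_def by (rule integral_distr) (use that in measurable)
  interpret char_convergence \<mu> "std_normal_vec :: (real^'n) measure"
  proof (rule char_convergence.intro)
    show "prob_space (\<mu> n)" for n
      unfolding \<mu>_def by (intro prob_space.prob_space_distr prob_space_unif_sphere D) measurable
    show "sets (\<mu> n) = sets borel" for n by (simp add: \<mu>_def)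
    fix t :: "real^'n"
    let ?w = "\<lambda>n k. \<Sum>i\<in>UNIV. t $ i * u n i k"
    let ?q = "\<lambda>n. \<Sum>k<D n. (?w n k)\<^sup>2"
    have q_lim: "?q \<longlonglongrightarrow> (norm t)\<^sup>2"
    proof -
      have "?q \<longlonglongrightarrow> (\<Sum>i\<in>UNIV. \<Sum>j\<in>UNIV. t $ i * t $ j * (if i = j then 1 else 0))"
        unfolding sum_square_combination by (intro tendsto_sum tendsto_mult tendsto_const gram)
      also have "(\<Sum>i\<in>UNIV. \<Sum>j\<in>UNIV. t $ i * t $ j * (if i = j then 1 else 0)) = (\<Sum>i\<in>UNIV. (t $ i)\<^sup>2)"
        by (simp add: power2_eq_square if_distrib cong: if_cong)
      also have "\<dots> = (norm t)\<^sup>2"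
        by (simp add: norm_vec_def L2_set_def sum_nonneg)
      finally show ?thesis .
    qed
    let ?c = "\<lambda>n. CLINT z|\<mu> n. iexp (t \<bullet> z)"
    have "filterlim (\<lambda>n. sqrt (real (D n))) at_top sequentially"
      using D(2) by (intro filterlim_compose[OF sqrt_at_top] filterlim_compose[OF filterlim_real_sequentially])
    then have bound_lim: "(\<lambda>n. (?q n + 8) / sqrt (real (D n))) \<longlonglongrightarrow> 0"
      by (intro tendsto_divide_0[OF tendsto_add[OF q_lim tendsto_const]] filterlim_at_top_imp_at_infinity)
    have "(\<lambda>n. ?c n - complex_of_real (exp (- ?q n / 2))) \<longlonglongrightarrow> 0"
    proof (rule Lim_null_comparison[OF _ bound_lim], intro always_eventually allI)
      fix n
      have "?c n = (CLINT v|unif_sphere (D n). iexp (sqrt (real (D n)) * inner_vec (D n) v (?w n)))"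
        by (subst int_mu) (simp_all only: inner_projections iexp_measurable_inner)
      then show "cmod (?c n - complex_of_real (exp (- ?q n / 2))) \<le> (?q n + 8) / sqrt (real (D n))"
        using unif_sphere_char[OF D(1)[of n], of "?w n"] by simp
    qed
    moreover have "(\<lambda>n. complex_of_real (exp (- ?q n / 2))) \<longlonglongrightarrow> complex_of_real (exp (- (norm t)\<^sup>2 / 2))"
      by (intro tendsto_intros q_lim) auto
    ultimately have "(\<lambda>n. ?c n - complex_of_real (exp (- ?q n / 2)) + complex_of_real (exp (- ?q n / 2)))
        \<longlonglongrightarrow> 0 + complex_of_real (exp (- (norm t)\<^sup>2 / 2))"
      by (rule tendsto_add)
    then show "?c \<longlonglongrightarrow> (CLINT z|std_normal_vec. iexp (t \<bullet> z))"
      unfolding std_normal_vec_char by simp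
  qed (rule prob_space_std_normal_vec sets_std_normal_vec)+
  show ?thesis
    using bounded_continuous_tendsto[OF f] by (simp add: int_mu)
qed

text \<open>
  The uniform form of the sequential statement, by contradiction: violations with \<open>\<eta> = 1 / (n + 1)\<close> and
  \<open>d > n\<close> would make up a forbidden sequence. Uniformity is what permits random prototypes to be
  substituted for the vectors \<open>u i\<close>.
\<close>

proposition projections_clt_uniform:
  fixes f :: "real ^ 'n::finite \<Rightarrow> real"
  assumes f: "continuous_on UNIV f" "bounded (range f)" and \<delta>: "0 < \<delta>"
  shows "\<exists>\<eta>>0. \<exists>d0\<ge>1. \<forall>d\<ge>d0. \<forall>u::'n \<Rightarrow> nat \<Rightarrow> real.
     (\<forall>i j. \<bar>inner_vec d (u i) (u j) - (if i = j then 1 else 0)\<bar> \<le> \<eta>) \<longrightarrow>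
     \<bar>(\<integral>v. f (projections d u v) \<partial>unif_sphere d) - (\<integral>z. f z \<partial>std_normal_vec)\<bar> < \<delta>"
proof (rule ccontr)
  let ?I = "\<lambda>d u. \<integral>v. f (projections d u v) \<partial>unif_sphere d" and ?c = "\<integral>z. f z \<partial>std_normal_vec"
  let ?gram = "\<lambda>d (u :: 'n \<Rightarrow> nat \<Rightarrow> real) \<eta>. \<forall>i j. \<bar>inner_vec d (u i) (u j) - (if i = j then 1 else 0)\<bar> \<le> (\<eta>::real)"
  assume neg: "\<not> (\<exists>\<eta>>0. \<exists>d0\<ge>1. \<forall>d\<ge>d0. \<forall>u. ?gram d u \<eta> \<longrightarrow> \<bar>?I d u - ?c\<bar> < \<delta>)"
  have "\<exists>d u. Suc n \<le> d \<and> ?gram d u (1 / real (Suc n)) \<and> \<delta> \<le> \<bar>?I d u - ?c\<bar>" for n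
  proof (rule ccontr)
    assume "\<nexists>d u. Suc n \<le> d \<and> ?gram d u (1 / real (Suc n)) \<and> \<delta> \<le> \<bar>?I d u - ?c\<bar>"
    then have "\<forall>d\<ge>Suc n. \<forall>u. ?gram d u (1 / real (Suc n)) \<longrightarrow> \<bar>?I d u - ?c\<bar> < \<delta>"
      by (meson not_le)
    moreover have "0 < 1 / real (Suc n)" "1 \<le> Suc n" by auto
    ultimately show False using neg by blast
  qed
  then have "\<forall>n. \<exists>p. Suc n \<le> fst p \<and> ?gram (fst p) (snd p) (1 / real (Suc n)) \<and> \<delta> \<le> \<bar>?I (fst p) (snd p) - ?c\<bar>"
    by simp
  from choice[OF this] obtain p where p: "\<forall>n. Suc n \<le> fst (p n) \<and> ?gram (fst (p n)) (snd (p n)) (1 / real (Suc n)) \<and>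
      \<delta> \<le> \<bar>?I (fst (p n)) (snd (p n)) - ?c\<bar>" ..
  define D u where "D n = fst (p n)" and "u n = snd (p n)" for n
  have Du: "Suc n \<le> D n" "?gram (D n) (u n) (1 / real (Suc n))" "\<delta> \<le> \<bar>?I (D n) (u n) - ?c\<bar>" for n
    using p unfolding D_def u_def by blast+
  have "(\<lambda>n. ?I (D n) (u n)) \<longlonglongrightarrow> ?c"
  proof (rule projections_clt_sequence[OF _ _ _ f])
    show "1 \<le> D n" for n using Du(1)[of n] by linarith
    show "filterlim D at_top sequentially"
      by (rule filterlim_at_top_mono[OF filterlim_Suc]) (use Du(1) in auto)
    fix i j
    have "(\<lambda>n. inner_vec (D n) (u n i) (u n j) - (if i = j then 1 else 0)) \<longlonglongrightarrow> 0"
    proof (rule Lim_null_comparison)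
      show "(\<lambda>n. 1 / real (Suc n)) \<longlonglongrightarrow> 0" by (rule lim_1_over_n[THEN LIMSEQ_Suc])
      show "\<forall>\<^sub>F n in sequentially. norm (inner_vec (D n) (u n i) (u n j) - (if i = j then 1 else 0)) \<le> 1 / real (Suc n)"
        unfolding real_norm_def using Du(2) by (intro always_eventually allI) blast
    qed
    then show "(\<lambda>n. inner_vec (D n) (u n i) (u n j)) \<longlonglongrightarrow> (if i = j then 1 else 0)"
      by (rule LIM_zero_cancel)
  qed
  then obtain n where "\<bar>?I (D n) (u n) - ?c\<bar> < \<delta>"
    using LIMSEQ_D[OF _ \<delta>, of _ ?c] unfolding real_norm_def by blast
  then show False using Du(3)[of n] by linarith
qed

section \<open>Conditioning and tail bounds under independence\<close>

text \<open>
  The predicate \<^const>\<open>prob_space.indep_var\<close> forces both variables to have the same type. Stated as a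
  product law, independence survives composition with maps into different types.
\<close>

lemma (in prob_space) indep_var_compose_joint_law:
  assumes indep: "indep_var A V B Y" and f: "f \<in> measurable A A'" and g: "g \<in> measurable B B'"
  shows "distr M A' (\<lambda>\<omega>. f (V \<omega>)) \<Otimes>\<^sub>M distr M B' (\<lambda>\<omega>. g (Y \<omega>))
    = distr M (A' \<Otimes>\<^sub>M B') (\<lambda>\<omega>. (f (V \<omega>), g (Y \<omega>)))"
proof -
  have rv: "V \<in> measurable M A" "Y \<in> measurable M B"
    and joint: "distr M A V \<Otimes>\<^sub>M distr M B Y = distr M (A \<Otimes>\<^sub>M B) (\<lambda>\<omega>. (V \<omega>, Y \<omega>))"
    using indep by (auto simp: indep_var_distribution_eq)
  have fV: "distr M A' (\<lambda>\<omega>. f (V \<omega>)) = distr (distr M A V) A' f"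
    using f rv by (simp add: distr_distr comp_def)
  have gY: "distr M B' (\<lambda>\<omega>. g (Y \<omega>)) = distr (distr M B Y) B' g"
    using g rv by (simp add: distr_distr comp_def)
  have "prob_space (distr M B' (\<lambda>\<omega>. g (Y \<omega>)))"
    using g rv by (intro prob_space_distr) simp
  then have "sigma_finite_measure (distr (distr M B Y) B' g)"
    unfolding gY by (simp add: prob_space_imp_sigma_finite)
  then have "distr M A' (\<lambda>\<omega>. f (V \<omega>)) \<Otimes>\<^sub>M distr M B' (\<lambda>\<omega>. g (Y \<omega>))
      = distr (distr M A V \<Otimes>\<^sub>M distr M B Y) (A' \<Otimes>\<^sub>M B') (\<lambda>(x, y). (f x, g y))"
    unfolding fV gY using f g by (intro pair_measure_distr) simp_all
  also have "\<dots> = distr M (A' \<Otimes>\<^sub>M B') (\<lambda>\<omega>. (f (V \<omega>), g (Y \<omega>)))"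
    unfolding joint using f g rv by (subst distr_distr) (auto simp: comp_def)
  finally show ?thesis .
qed

text \<open>
  Given \<open>Y\<close>, an independent variable \<open>V\<close> keeps its law, so conditioning on \<open>Y\<close> means integrating out \<open>V\<close>
  with \<open>Y\<close> held fixed. The candidate is checked against the events \<open>Y \<in> S\<close> by Fubini.
\<close>

lemma (in prob_space) real_cond_exp_indep:
  fixes h :: "'v \<times> 'y \<Rightarrow> real"
  assumes rv[measurable]: "V \<in> measurable M A" "Y \<in> measurable M B"
    and joint: "distr M A V \<Otimes>\<^sub>M distr M B Y = distr M (A \<Otimes>\<^sub>M B) (\<lambda>\<omega>. (V \<omega>, Y \<omega>))"
    and hm[measurable]: "h \<in> borel_measurable (A \<Otimes>\<^sub>M B)"
    and bdd: "\<And>z. \<bar>h z\<bar> \<le> C"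
  shows "AE \<omega> in M. real_cond_exp M (vimage_algebra (space M) Y B) (\<lambda>\<omega>. h (V \<omega>, Y \<omega>)) \<omega>
           = (\<integral>v. h (v, Y \<omega>) \<partial>distr M A V)"
proof -
  interpret PV: prob_space "distr M A V" by (rule prob_space_distr) (rule rv)
  interpret PY: prob_space "distr M B Y" by (rule prob_space_distr) (rule rv)
  interpret PP: pair_prob_space "distr M A V" "distr M B Y" ..
  define F where "F = vimage_algebra (space M) Y B"
  have Ysp: "Y \<in> space M \<rightarrow> space B" using rv(2) by (rule measurable_space[THEN Pi_I])
  have sets_F: "sets F = {Y -` S \<inter> space M | S. S \<in> sets B}"
    unfolding F_def by (rule sets_vimage_algebra2[OF Ysp])
  have space_F: "space F = space M" by (simp add: F_def)
  have sub: "subalgebra M F"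
    unfolding subalgebra_def space_F sets_F using measurable_sets[OF rv(2)] by auto
  interpret F: finite_measure_subalgebra M F
    by unfold_locales (rule sub)
  define g where "g y = (\<integral>v. h (v, y) \<partial>distr M A V)" for y
  have gm[measurable]: "g \<in> borel_measurable B"
  proof -
    have "(\<lambda>y. \<integral>v. h (v, y) \<partial>distr M A V) \<in> borel_measurable B"
      by measurable
    then show ?thesis by (simp add: g_def[abs_def])
  qed
  have C0: "0 \<le> C" using bdd[of undefined] by linarith
  have g_le: "\<bar>g y\<bar> \<le> C" if y: "y \<in> space B" for y
  proof -
    have [measurable]: "(\<lambda>v. h (v, y)) \<in> borel_measurable A"
      using y by measurable
    have "\<bar>g y\<bar> \<le> (\<integral>v. \<bar>h (v, y)\<bar> \<partial>distr M A V)"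
      using integral_norm_bound[of "distr M A V" "\<lambda>v. h (v, y)"] by (simp add: g_def)
    also have "\<dots> \<le> (\<integral>v. C \<partial>distr M A V)"
      by (rule integral_mono) (auto intro!: PV.integrable_const_bound[where B = C] simp: bdd)
    finally show ?thesis using PV.prob_space by simp
  qed
  have int: "integrable M (\<lambda>\<omega>. h (V \<omega>, Y \<omega>))"
    by (rule integrable_const_bound[where B = C]) (auto simp: bdd)
  have intg: "integrable M (\<lambda>\<omega>. g (Y \<omega>))"
    by (rule integrable_const_bound[where B = C]) (auto intro!: AE_I2 g_le measurable_space[OF rv(2)])
  have "AE \<omega> in M. real_cond_exp M F (\<lambda>\<omega>. h (V \<omega>, Y \<omega>)) \<omega> = g (Y \<omega>)"
  proof (rule F.real_cond_exp_charact[OF _ int intg])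
    have "Y \<in> measurable F B"
      unfolding F_def by (rule measurable_vimage_algebra1[OF Ysp])
    then show "(\<lambda>\<omega>. g (Y \<omega>)) \<in> borel_measurable F"
      by (rule measurable_compose) (rule gm)
    fix E assume "E \<in> sets F"
    then obtain S where S[measurable]: "S \<in> sets B" and E: "E = Y -` S \<inter> space M"
      unfolding sets_F by auto
    let ?k = "\<lambda>(v, y). indicator S y * h (v, y)"
    have "integrable (distr M A V \<Otimes>\<^sub>M distr M B Y) ?k"
    proof (rule PP.P.integrable_const_bound[where B = C])
      show "AE z in distr M A V \<Otimes>\<^sub>M distr M B Y. norm (?k z) \<le> C"
        using bdd C0 by (intro AE_I2) (auto simp: indicator_def split_beta)
    qed measurable
    then have fub: "(\<integral>y. (\<integral>v. indicator S y * h (v, y) \<partial>distr M A V) \<partial>distr M B Y)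
        = (\<integral>z. ?k z \<partial>(distr M A V \<Otimes>\<^sub>M distr M B Y))"
      by (rule PP.integral_snd)
    have "(\<integral>\<omega>\<in>E. h (V \<omega>, Y \<omega>) \<partial>M) = (\<integral>\<omega>. ?k (V \<omega>, Y \<omega>) \<partial>M)"
      unfolding set_lebesgue_integral_def
      by (intro Bochner_Integration.integral_cong) (auto simp: E indicator_def)
    also have "\<dots> = (\<integral>z. ?k z \<partial>(distr M A V \<Otimes>\<^sub>M distr M B Y))"
      unfolding joint by (rule integral_distr[symmetric]) measurable
    also have "\<dots> = (\<integral>y. indicator S y * g y \<partial>distr M B Y)"
      unfolding fub[symmetric] by (simp add: g_def)
    also have "\<dots> = (\<integral>\<omega>. indicator S (Y \<omega>) * g (Y \<omega>) \<partial>M)"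
      by (rule integral_distr) measurable
    also have "\<dots> = (\<integral>\<omega>\<in>E. g (Y \<omega>) \<partial>M)"
      unfolding set_lebesgue_integral_def
      by (intro Bochner_Integration.integral_cong) (auto simp: E indicator_def)
    finally show "(\<integral>\<omega>\<in>E. h (V \<omega>, Y \<omega>) \<partial>M) = (\<integral>\<omega>\<in>E. g (Y \<omega>) \<partial>M)" .
  qed
  then show ?thesis by (simp add: F_def g_def)
qed

text \<open>
  A bound for almost every fixed value of \<open>Y\<close> integrates to a bound for the pair.
\<close>

lemma (in prob_space) prob_indep_bound:
  assumes rv[measurable]: "V \<in> measurable M A" "Y \<in> measurable M B"
    and joint: "distr M A V \<Otimes>\<^sub>M distr M B Y = distr M (A \<Otimes>\<^sub>M B) (\<lambda>\<omega>. (V \<omega>, Y \<omega>))"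
    and E[measurable]: "Measurable.pred (A \<Otimes>\<^sub>M B) E"
    and bound: "AE y in distr M B Y. measure (distr M A V) {v \<in> space A. E (v, y)} \<le> c"
    and c: "0 \<le> c"
  shows "prob {\<omega> \<in> space M. E (V \<omega>, Y \<omega>)} \<le> c"
proof -
  interpret PV: prob_space "distr M A V" by (rule prob_space_distr) (rule rv)
  interpret PY: prob_space "distr M B Y" by (rule prob_space_distr) (rule rv)
  interpret PP: pair_prob_space "distr M A V" "distr M B Y" ..
  let ?S = "{z \<in> space (A \<Otimes>\<^sub>M B). E z}"
  have S: "?S \<in> sets (A \<Otimes>\<^sub>M B)" by measurable
  have "emeasure M {\<omega> \<in> space M. E (V \<omega>, Y \<omega>)} = emeasure (distr M (A \<Otimes>\<^sub>M B) (\<lambda>\<omega>. (V \<omega>, Y \<omega>))) ?S"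
    using S measurable_space[OF rv(1)] measurable_space[OF rv(2)]
    by (subst emeasure_distr) (auto simp: space_pair_measure intro!: arg_cong2[where f = emeasure])
  also have "\<dots> = emeasure (distr M A V \<Otimes>\<^sub>M distr M B Y) ?S"
    by (simp add: joint)
  also have "\<dots> = (\<integral>\<^sup>+y. emeasure (distr M A V) ((\<lambda>v. (v, y)) -` ?S) \<partial>distr M B Y)"
    using S by (intro PP.emeasure_pair_measure_alt2) simp
  also have "\<dots> \<le> (\<integral>\<^sup>+y. ennreal c \<partial>distr M B Y)"
  proof (rule nn_integral_mono_AE)
    show "AE y in distr M B Y. emeasure (distr M A V) ((\<lambda>v. (v, y)) -` ?S) \<le> ennreal c"
      using bound AE_space
    proof eventually_elim
      case (elim y)
      then have "(\<lambda>v. (v, y)) -` ?S = {v \<in> space A. E (v, y)}" by (auto simp: space_pair_measure)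
      then show ?case using elim by (simp add: PV.emeasure_eq_measure ennreal_leI)
    qed
  qed
  also have "\<dots> = ennreal c" using PY.emeasure_space_1 by simp
  finally show ?thesis using c by (simp add: emeasure_eq_measure)
qed

text \<open>
  Two independent uniform directions are nearly orthogonal: their inner product is of order
  \<open>1 / sqrt d\<close>. This single estimate serves for the query against a prototype, where it bounds \<open>Z\<close>, and for
  two prototypes, where it bounds the Gram matrix.
\<close>

lemma (in prob_space) indep_sphere_inner_tail:
  assumes d: "d \<ge> 1" and K: "0 < K"
    and rv: "V \<in> measurable M (borel_vec d)" "W \<in> measurable M (borel_vec d)"
    and joint: "distr M (borel_vec d) V \<Otimes>\<^sub>M distr M (borel_vec d) W
      = distr M (borel_vec d \<Otimes>\<^sub>M borel_vec d) (\<lambda>\<omega>. (V \<omega>, W \<omega>))"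
    and V: "distr M (borel_vec d) V = unif_sphere d" and W: "distr M (borel_vec d) W = unif_sphere d"
  shows "prob {\<omega> \<in> space M. K < \<bar>sqrt (real d) * inner_vec d (V \<omega>) (W \<omega>)\<bar>} \<le> 4 / K\<^sup>2 + 4 / real d"
proof -
  have "prob {\<omega> \<in> space M. (\<lambda>(v, w). K < \<bar>sqrt (real d) * inner_vec d v w\<bar>) (V \<omega>, W \<omega>)} \<le> 4 / K\<^sup>2 + 4 / real d"
  proof (rule prob_indep_bound[OF rv joint])
    show "Measurable.pred (borel_vec d \<Otimes>\<^sub>M borel_vec d) (\<lambda>(v, w). K < \<bar>sqrt (real d) * inner_vec d v w\<bar>)"
      by measurable
    show "AE w in distr M (borel_vec d) W.
        measure (distr M (borel_vec d) V) {v \<in> space (borel_vec d). case (v, w) of (v, w) \<Rightarrow> K < \<bar>sqrt (real d) * inner_vec d v w\<bar>}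
         \<le> 4 / K\<^sup>2 + 4 / real d"
      unfolding V W using unif_sphere_unit_norm[OF d]
    proof eventually_elim
      case (elim w)
      then have "(\<Sum>k<d. (w k)\<^sup>2) = 1"
        by (simp add: L2_set_def)
      then show ?case
        using unif_sphere_tail[OF d K, of w] sets_eq_imp_space_eq[OF sets_unif_sphere[of d]] by simp
    qed
  qed (use K in auto)
  then show ?thesis by simp
qed

section \<open>Scores\<close>

lemma vector_3_eq: "(vector [a, b, c] :: real ^ 3) = (\<chi> i. if i = 1 then a else if i = 2 then b else c)"
  by (simp add: vec_eq_iff forall_3)

text \<open>
  Here \<open>I\<close> stands for the inner product of the two directions. With \<open>R = \<rho> (1 + \<tau> x)\<close> and
  \<open>R0 = \<rho> (1 + \<tau> x0)\<close>, expanding \<open>R\<^sup>2 - 2 R0 R I - \<rho>\<^sup>2\<close> to first order in \<open>\<tau>\<close> for the square, and to order zero for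
  the product, gives the first two terms on the left. The bracket collects all that is left over; it is the
  remainder of the score.
\<close>

lemma score_identity:
  fixes \<rho> e s R0 R I :: real
  assumes "\<rho> > 0" "e > 0"
  defines "\<tau> \<equiv> e / \<rho>" and "x0 \<equiv> (R0 - \<rho>) / e" and "x \<equiv> (R - \<rho>) / e"
  shows "s * \<tau> * x - s * I + (s * \<tau> * \<tau> * x\<^sup>2 / 2 - (\<tau> * x0 + \<tau> * x + \<tau>\<^sup>2 * x0 * x) * (s * I))
     = s / (2 * \<rho>\<^sup>2) * (R\<^sup>2 - 2 * R0 * R * I - \<rho>\<^sup>2)"
proof -
  have a: "\<tau> * x = R / \<rho> - 1" "\<tau> * x0 = R0 / \<rho> - 1"
    using assms by (auto simp: field_simps)
  have "s * \<tau> * x - s * I + (s * \<tau> * \<tau> * x\<^sup>2 / 2 - (\<tau> * x0 + \<tau> * x + \<tau>\<^sup>2 * x0 * x) * (s * I))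
     = s * (\<tau> * x) + s * (\<tau> * x)\<^sup>2 / 2 - (1 + \<tau> * x0) * (1 + \<tau> * x) * (s * I)"
    by (simp add: power2_eq_square algebra_simps)
  also have "\<dots> = s / (2 * \<rho>\<^sup>2) * (R\<^sup>2 - 2 * R0 * R * I - \<rho>\<^sup>2)"
    unfolding a using assms(1) by (simp add: power2_eq_square field_simps)
  finally show ?thesis .
qed

lemma dist_vec_scaled_square:
  assumes "L2_set u {..<d} = 1" "L2_set v {..<d} = 1"
  shows "(dist_vec d (\<lambda>k\<in>{..<d}. a * u k) (\<lambda>k\<in>{..<d}. b * v k))\<^sup>2 = a\<^sup>2 + b\<^sup>2 - 2 * a * b * inner_vec d u v"
proof -
  have uv: "(\<Sum>k<d. (u k)\<^sup>2) = 1" "(\<Sum>k<d. (v k)\<^sup>2) = 1"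
    using assms by (simp_all add: L2_set_def)
  have "(dist_vec d (\<lambda>k\<in>{..<d}. a * u k) (\<lambda>k\<in>{..<d}. b * v k))\<^sup>2 = (\<Sum>k<d. (a * u k - b * v k)\<^sup>2)"
    by (simp add: L2_set_def sum_nonneg)
  also have "\<dots> = (\<Sum>k<d. a\<^sup>2 * (u k)\<^sup>2 + b\<^sup>2 * (v k)\<^sup>2 - 2 * a * b * (u k * v k))"
    by (simp add: power2_eq_square algebra_simps)
  also have "\<dots> = a\<^sup>2 * (\<Sum>k<d. (u k)\<^sup>2) + b\<^sup>2 * (\<Sum>k<d. (v k)\<^sup>2) - 2 * a * b * inner_vec d u v"
    by (simp only: sum.distrib sum_subtractf sum_distrib_left)
  finally show ?thesis by (simp add: uv)
qed

text \<open>
  A Chebyshev bound at level \<open>K\<close> leaves an error \<open>a / K\<^sup>2\<close>, which is removed by choosing \<open>K\<close> large after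
  the accuracy is given; \<open>b\<close> may depend on everything except the dimension.
\<close>

lemma conv_in_probI_tail_bound:
  fixes M :: "nat \<Rightarrow> 'a measure"
  assumes a: "0 \<le> a"
    and bound: "\<And>\<delta> K. 0 < \<delta> \<Longrightarrow> 0 < K \<Longrightarrow> \<exists>b. \<forall>\<^sub>F d in sequentially.
      measure (M d) {\<omega> \<in> space (M d). \<delta> < \<bar>X d \<omega> - c\<bar>} \<le> a / K\<^sup>2 + b / real d"
  shows "conv_in_prob M X c"
  unfolding conv_in_prob_def
proof (intro allI impI)
  fix \<delta> :: real assume \<delta>: "0 < \<delta>"
  show "(\<lambda>d. measure (M d) {\<omega> \<in> space (M d). \<delta> < \<bar>X d \<omega> - c\<bar>}) \<longlonglongrightarrow> 0"
  proof (rule order_tendstoI)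
    fix e :: real assume e: "0 < e"
    define K where "K = sqrt (2 * (a + 1) / e)"
    have K: "0 < K" "K\<^sup>2 = 2 * (a + 1) / e" using e a by (auto simp: K_def)
    have aK: "a / K\<^sup>2 + 0 < e" using e a by (simp add: K(2) field_simps add_nonneg_pos)
    obtain b where b: "\<forall>\<^sub>F d in sequentially.
        measure (M d) {\<omega> \<in> space (M d). \<delta> < \<bar>X d \<omega> - c\<bar>} \<le> a / K\<^sup>2 + b / real d"
      using bound[OF \<delta> K(1)] by blast
    have "(\<lambda>d. a / K\<^sup>2 + b / real d) \<longlonglongrightarrow> a / K\<^sup>2 + 0"
      by (intro tendsto_add tendsto_const lim_const_over_n)
    from order_tendstoD(2)[OF this aK] b
    show "\<forall>\<^sub>F d in sequentially. measure (M d) {\<omega> \<in> space (M d). \<delta> < \<bar>X d \<omega> - c\<bar>} < e"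
      by eventually_elim linarith
  next
    fix e :: real assume "e < 0"
    then show "\<forall>\<^sub>F d in sequentially. e < measure (M d) {\<omega> \<in> space (M d). \<delta> < \<bar>X d \<omega> - c\<bar>}"
      by (intro always_eventually allI less_le_trans[OF _ measure_nonneg])
  qed
qed

theorem lemma1:
  fixes N :: "nat \<Rightarrow> 'b measure" and R :: "nat \<Rightarrow> 'b \<Rightarrow> real" and U :: "nat \<Rightarrow> 'b \<Rightarrow> nat \<Rightarrow> real"
    and P :: "'c measure" and Xi :: "'c \<Rightarrow> real"
    and M :: "nat \<Rightarrow> 'a measure"
    and Rc :: "nat \<Rightarrow> nat \<Rightarrow> 'a \<Rightarrow> real" and Uc :: "nat \<Rightarrow> nat \<Rightarrow> 'a \<Rightarrow> nat \<Rightarrow> real"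
  defines "rho \<equiv> \<lambda>d. prob_space.expectation (N d) (R d)"
    and "eps \<equiv> \<lambda>d. stddev (N d) (R d)"
  defines "xi \<equiv> \<lambda>d \<omega>. (R d \<omega> - rho d) / eps d"
    and "tau \<equiv> \<lambda>d. eps d / rho d"
  defines "lam \<equiv> \<lambda>d. sqrt (real d) * tau d"
  defines "xic \<equiv> \<lambda>d i \<omega>. (Rc d i \<omega> - rho d) / eps d"
    and "X \<equiv> \<lambda>d i \<omega>. \<lambda>k\<in>{..<d}. Rc d i \<omega> * Uc d i \<omega> k"
    and "Z \<equiv> \<lambda>d i \<omega>. sqrt (real d) * inner_vec d (Uc d 0 \<omega>) (Uc d i \<omega>)"
  assumes N: "\<And>d. d \<ge> 1 \<Longrightarrow> prob_space (N d)"
    and R_meas: "\<And>d. d \<ge> 1 \<Longrightarrow> R d \<in> borel_measurable (N d)"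
    and R_pos: "\<And>d. d \<ge> 1 \<Longrightarrow> AE \<omega> in N d. 0 < R d \<omega>"
    and R_int: "\<And>d. d \<ge> 1 \<Longrightarrow> integrable (N d) (R d)"
    and R_sq_int: "\<And>d. d \<ge> 1 \<Longrightarrow> integrable (N d) (\<lambda>\<omega>. (R d \<omega>)\<^sup>2)"
    and eps_pos: "\<And>d. d \<ge> 1 \<Longrightarrow> 0 < eps d"
    and U_meas: "\<And>d. d \<ge> 1 \<Longrightarrow> U d \<in> measurable (N d) (borel_vec d)"
    and U_unif: "\<And>d. d \<ge> 1 \<Longrightarrow> distr (N d) (borel_vec d) (U d) = unif_sphere d"
    and RU_indep: "\<And>d. d \<ge> 1 \<Longrightarrow> prob_space.indep_set (N d)
          (sets (vimage_algebra (space (N d)) (R d) borel))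
          (sets (vimage_algebra (space (N d)) (U d) (borel_vec d)))"
    and tau_lim: "tau \<longlonglongrightarrow> 0"
    and Xi: "prob_space P" "Xi \<in> borel_measurable P"
    and xi_lim: "weak_conv_m (\<lambda>d. distr (N d) borel (xi d)) (distr P borel Xi)"
    and M: "\<And>d. d \<ge> 1 \<Longrightarrow> prob_space (M d)"
    and copies_indep: "\<And>d. d \<ge> 1 \<Longrightarrow>
          prob_space.indep_vars (M d) (\<lambda>_. borel \<Otimes>\<^sub>M borel_vec d) (\<lambda>i \<omega>. (Rc d i \<omega>, Uc d i \<omega>)) {0..3}"
    and copies_law: "\<And>d i. d \<ge> 1 \<Longrightarrow> i \<in> {0..3} \<Longrightarrow>
          distr (M d) (borel \<Otimes>\<^sub>M borel_vec d) (\<lambda>\<omega>. (Rc d i \<omega>, Uc d i \<omega>))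
            = distr (N d) (borel \<Otimes>\<^sub>M borel_vec d) (\<lambda>\<omega>. (R d \<omega>, U d \<omega>))"
  shows "\<exists>r :: nat \<Rightarrow> nat \<Rightarrow> 'a \<Rightarrow> real.
      (\<forall>d\<ge>1. \<forall>i\<in>{1..3}. r d i \<in> borel_measurable (M d)) \<and>
      (\<forall>d\<ge>1. AE \<omega> in M d.
         let S = (\<lambda>i. lam d * xic d i \<omega> - Z d i \<omega> + r d i \<omega>) in
         \<forall>i\<in>{1..3}. \<forall>j\<in>{1..3}.
           dist_vec d (X d 0 \<omega>) (X d i \<omega>) \<le> dist_vec d (X d 0 \<omega>) (X d j \<omega>) \<longleftrightarrow> S i \<le> S j) \<and>
      cond_weak_conv_in_prob M
        (\<lambda>d. generated_by (M d) (borel \<Otimes>\<^sub>M borel_vec d) (\<lambda>i \<omega>. (Rc d i \<omega>, Uc d i \<omega>)) {1..3})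
        (\<lambda>d \<omega>. vector [Z d 1 \<omega>, Z d 2 \<omega>, Z d 3 \<omega>] :: real ^ 3) std_normal_vec \<and>
      (lam \<in> O(\<lambda>_. 1) \<longrightarrow>
         conv_in_prob M (\<lambda>d \<omega>. MAX i\<in>{1..3}. \<bar>r d i \<omega>\<bar>) 0) \<and>
      (filterlim lam at_top sequentially \<longrightarrow>
         conv_in_prob M (\<lambda>d \<omega>. 1 / lam d * (MAX i\<in>{1..3}. \<bar>r d i \<omega>\<bar>)) 0)"
proof -
  have prob_M: "prob_space (M d)" if "d \<ge> 1" for d using M that .
  have pair_rv: "(\<lambda>\<omega>. (Rc d i \<omega>, Uc d i \<omega>)) \<in> measurable (M d) (borel \<Otimes>\<^sub>M borel_vec d)"
    if "d \<ge> 1" "i \<in> {0..3}" for d i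
  proof -
    interpret prob_space "M d" using prob_M that by simp
    show ?thesis using copies_indep[OF that(1)] that(2) by (simp add: indep_vars_def2)
  qed
  have R_rv: "Rc d i \<in> borel_measurable (M d)" if "d \<ge> 1" "i \<in> {0..3}" for d i
    using measurable_compose[OF pair_rv[OF that] measurable_fst] by simp
  have U_rv: "Uc d i \<in> measurable (M d) (borel_vec d)" if "d \<ge> 1" "i \<in> {0..3}" for d i
    using measurable_compose[OF pair_rv[OF that] measurable_snd] by simp
  have R_law: "distr (M d) borel (Rc d i) = distr (N d) borel (R d)" if d: "d \<ge> 1" and i: "i \<in> {0..3}" for d i
  proof -
    have "distr (distr (M d) (borel \<Otimes>\<^sub>M borel_vec d) (\<lambda>\<omega>. (Rc d i \<omega>, Uc d i \<omega>))) borel fst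
        = distr (distr (N d) (borel \<Otimes>\<^sub>M borel_vec d) (\<lambda>\<omega>. (R d \<omega>, U d \<omega>))) borel fst"
      unfolding copies_law[OF that] ..
    then show ?thesis
      using pair_rv[OF that] R_meas[OF d] U_meas[OF d] by (simp add: distr_distr comp_def)
  qed
  have U_law: "distr (M d) (borel_vec d) (Uc d i) = unif_sphere d" if d: "d \<ge> 1" and i: "i \<in> {0..3}" for d i
  proof -
    have "distr (distr (M d) (borel \<Otimes>\<^sub>M borel_vec d) (\<lambda>\<omega>. (Rc d i \<omega>, Uc d i \<omega>))) (borel_vec d) snd
        = distr (distr (N d) (borel \<Otimes>\<^sub>M borel_vec d) (\<lambda>\<omega>. (R d \<omega>, U d \<omega>))) (borel_vec d) snd"
      unfolding copies_law[OF that] ..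
    then show ?thesis
      using pair_rv[OF that] R_meas[OF d] U_meas[OF d] U_unif[OF d] by (simp add: distr_distr comp_def)
  qed
  have U_norm: "AE \<omega> in M d. \<forall>i\<in>{0..3}. L2_set (Uc d i \<omega>) {..<d} = 1" if d: "d \<ge> 1" for d
  proof (rule AE_finite_allI)
    fix i :: nat assume i: "i \<in> {0..3}"
    have "AE x in distr (M d) (borel_vec d) (Uc d i). L2_set x {..<d} = 1"
      unfolding U_law[OF d i] by (rule unif_sphere_unit_norm[OF d])
    then show "AE \<omega> in M d. L2_set (Uc d i \<omega>) {..<d} = 1"
      by (subst (asm) AE_distr_iff[OF U_rv[OF d i]]) measurable
  qed simp
  have inner_tail: "measure (M d) {\<omega> \<in> space (M d). K < \<bar>sqrt (real d) * inner_vec d (Uc d i \<omega>) (Uc d j \<omega>)\<bar>}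
      \<le> 4 / K\<^sup>2 + 4 / real d"
    if d: "d \<ge> 1" and i: "i \<in> {0..3}" and j: "j \<in> {0..3}" and ij: "i \<noteq> j" and K: "0 < K" for d i j K
  proof -
    interpret prob_space "M d" using prob_M d by simp
    have "indep_var (Pi\<^sub>M {i} (\<lambda>_. borel \<Otimes>\<^sub>M borel_vec d)) (\<lambda>\<omega>. \<lambda>l\<in>{i}. (Rc d l \<omega>, Uc d l \<omega>))
        (Pi\<^sub>M {j} (\<lambda>_. borel \<Otimes>\<^sub>M borel_vec d)) (\<lambda>\<omega>. \<lambda>l\<in>{j}. (Rc d l \<omega>, Uc d l \<omega>))"
      by (rule indep_var_restrict[OF copies_indep[OF d]]) (use i j ij in auto)
    from indep_var_compose_joint_law[OF this, of "\<lambda>x. snd (x i)" "borel_vec d" "\<lambda>x. snd (x j)" "borel_vec d"]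
    have "distr (M d) (borel_vec d) (Uc d i) \<Otimes>\<^sub>M distr (M d) (borel_vec d) (Uc d j)
        = distr (M d) (borel_vec d \<Otimes>\<^sub>M borel_vec d) (\<lambda>\<omega>. (Uc d i \<omega>, Uc d j \<omega>))"
      by simp
    then show ?thesis
      by (rule indep_sphere_inner_tail[OF d K U_rv[OF d i] U_rv[OF d j] _ U_law[OF d i] U_law[OF d j]])
  qed
  have rho_pos: "0 < rho d" if d: "d \<ge> 1" for d
  proof -
    interpret prob_space "N d" using N d by simp
    have "0 \<le> rho d" unfolding rho_def
      by (rule integral_nonneg_AE) (use R_pos[OF d] in eventually_elim, auto)
    moreover have "rho d \<noteq> 0"
    proof
      assume "rho d = 0"
      then have "AE \<omega> in N d. R d \<omega> = 0"
        unfolding rho_def using R_pos[OF d] R_int[OF d]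
        by (subst (asm) integral_nonneg_eq_0_iff_AE) (auto elim: eventually_mono)
      with R_pos[OF d] have "AE \<omega> in N d. False" by eventually_elim simp
      then show False by simp
    qed
    ultimately show ?thesis by linarith
  qed
  have tau_pos: "0 < tau d" and lam_pos: "0 < lam d" if "d \<ge> 1" for d
    using rho_pos[OF that] eps_pos[OF that] that by (simp_all add: tau_def lam_def)
  have xi_tail: "measure (M d) {\<omega> \<in> space (M d). K < \<bar>xic d i \<omega>\<bar>} \<le> 1 / K\<^sup>2"
    if d: "d \<ge> 1" and i: "i \<in> {0..3}" and K: "0 < K" for d i K
  proof -
    interpret N: prob_space "N d" using N d by simp
    have e: "0 < eps d" using eps_pos d by simp
    have e2: "(eps d)\<^sup>2 = N.variance (R d)"
      unfolding eps_def by (simp add: integral_nonneg_AE)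
    let ?A = "{y::real. K < \<bar>(y - rho d) / eps d\<bar>}"
    have mA: "?A \<in> sets borel" by measurable
    have "measure (M d) {\<omega> \<in> space (M d). K < \<bar>xic d i \<omega>\<bar>} = measure (distr (M d) borel (Rc d i)) ?A"
      using mA R_rv[OF d i] by (subst measure_distr) (auto simp: xic_def intro!: arg_cong2[where f = measure])
    also have "\<dots> = measure (N d) {\<omega> \<in> space (N d). K < \<bar>(R d \<omega> - rho d) / eps d\<bar>}"
      unfolding R_law[OF d i] using mA R_meas[OF d]
      by (subst measure_distr) (auto intro!: arg_cong2[where f = measure])
    also have "\<dots> \<le> measure (N d) {\<omega> \<in> space (N d). K * eps d \<le> \<bar>R d \<omega> - N.expectation (R d)\<bar>}"
      using R_meas[OF d] e
      by (intro N.finite_measure_mono) (auto simp: rho_def abs_divide pos_less_divide_eq)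
    also have "\<dots> \<le> N.variance (R d) / (K * eps d)\<^sup>2"
      using R_meas[OF d] R_sq_int[OF d] K e by (intro N.Chebyshev_inequality) auto
    also have "\<dots> = 1 / K\<^sup>2"
      unfolding e2[symmetric] using e by (simp add: power_mult_distrib)
    finally show ?thesis .
  qed
  have xic_rv: "xic d i \<in> borel_measurable (M d)" if "d \<ge> 1" "i \<in> {0..3}" for d i
    unfolding xic_def using R_rv[OF that] by measurable
  have Z_rv: "Z d i \<in> borel_measurable (M d)" if "d \<ge> 1" "i \<in> {0..3}" for d i
  proof -
    have [measurable]: "Uc d 0 \<in> measurable (M d) (borel_vec d)" "Uc d i \<in> measurable (M d) (borel_vec d)"
      using U_rv that by auto
    show ?thesis unfolding Z_def by measurable
  qed

  \<comment> \<open>The exact left-over of the score, so that the scores are a positive affine function of the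
      squared distances and the ordering holds without error.\<close>
  define r where "r d i \<omega> = lam d * tau d * (xic d i \<omega>)\<^sup>2 / 2
      - (tau d * xic d 0 \<omega> + tau d * xic d i \<omega> + (tau d)\<^sup>2 * xic d 0 \<omega> * xic d i \<omega>) * Z d i \<omega>" for d i \<omega>
  have r_rv: "r d i \<in> borel_measurable (M d)" if d: "d \<ge> 1" and i: "i \<in> {1..3}" for d i
  proof -
    have [measurable]: "xic d 0 \<in> borel_measurable (M d)" "xic d i \<in> borel_measurable (M d)" "Z d i \<in> borel_measurable (M d)"
      using xic_rv Z_rv d i by auto
    show ?thesis unfolding r_def by measurable
  qed

  have ordering: "AE \<omega> in M d.
         let S = (\<lambda>i. lam d * xic d i \<omega> - Z d i \<omega> + r d i \<omega>) in
         \<forall>i\<in>{1..3}. \<forall>j\<in>{1..3}.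
           dist_vec d (X d 0 \<omega>) (X d i \<omega>) \<le> dist_vec d (X d 0 \<omega>) (X d j \<omega>) \<longleftrightarrow> S i \<le> S j" if d: "d \<ge> 1" for d
    using U_norm[OF d]
  proof eventually_elim
    case (elim \<omega>)
    \<comment> \<open>The common positive factor that turns squared distances into scores.\<close>
    define \<kappa> where "\<kappa> = sqrt (real d) / (2 * (rho d)\<^sup>2)"
    have \<kappa>: "0 < \<kappa>" using rho_pos[OF d] d by (simp add: \<kappa>_def)
    have score: "lam d * xic d i \<omega> - Z d i \<omega> + r d i \<omega>
        = \<kappa> * ((dist_vec d (X d 0 \<omega>) (X d i \<omega>))\<^sup>2 - (Rc d 0 \<omega>)\<^sup>2 - (rho d)\<^sup>2)" if i: "i \<in> {1..3}" for i
    proof -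
      have "(dist_vec d (X d 0 \<omega>) (X d i \<omega>))\<^sup>2
          = (Rc d 0 \<omega>)\<^sup>2 + (Rc d i \<omega>)\<^sup>2 - 2 * Rc d 0 \<omega> * Rc d i \<omega> * inner_vec d (Uc d 0 \<omega>) (Uc d i \<omega>)"
        unfolding X_def using elim i by (intro dist_vec_scaled_square) auto
      then show ?thesis
        using score_identity[OF rho_pos[OF d] eps_pos[OF d], of "sqrt (real d)" "Rc d i \<omega>" "inner_vec d (Uc d 0 \<omega>) (Uc d i \<omega>)" "Rc d 0 \<omega>"]
        unfolding r_def lam_def tau_def xic_def Z_def \<kappa>_def by simp
    qed
    have "dist_vec d (X d 0 \<omega>) (X d i \<omega>) \<le> dist_vec d (X d 0 \<omega>) (X d j \<omega>) \<longleftrightarrow>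
        lam d * xic d i \<omega> - Z d i \<omega> + r d i \<omega> \<le> lam d * xic d j \<omega> - Z d j \<omega> + r d j \<omega>"
      if "i \<in> {1..3}" "j \<in> {1..3}" for i j
      unfolding score[OF that(1)] score[OF that(2)] mult_le_cancel_left_pos[OF \<kappa>]
      by (simp add: abs_le_square_iff[symmetric] L2_set_nonneg)
    then show ?case unfolding Let_def by blast
  qed

  have clt: "cond_weak_conv_in_prob M
        (\<lambda>d. generated_by (M d) (borel \<Otimes>\<^sub>M borel_vec d) (\<lambda>i \<omega>. (Rc d i \<omega>, Uc d i \<omega>)) {1..3})
        (\<lambda>d \<omega>. vector [Z d 1 \<omega>, Z d 2 \<omega>, Z d 3 \<omega>] :: real ^ 3) std_normal_vec"
    unfolding cond_weak_conv_in_prob_def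
  proof (intro allI impI)
    fix f :: "real ^ 3 \<Rightarrow> real"
    assume f: "continuous_on UNIV f" "bounded (range f)"
    have f_borel[measurable]: "f \<in> borel_measurable borel"
      using f(1) by (rule borel_measurable_continuous_onI)
    obtain C where C: "\<And>z. \<bar>f z\<bar> \<le> C"
      using f(2) by (auto simp: bounded_iff)
    let ?c = "\<integral>z. f z \<partial>std_normal_vec"
    let ?F = "\<lambda>d. generated_by (M d) (borel \<Otimes>\<^sub>M borel_vec d) (\<lambda>i \<omega>. (Rc d i \<omega>, Uc d i \<omega>)) {1..3}"
    let ?E = "\<lambda>d. real_cond_exp (M d) (?F d) (\<lambda>\<omega>. f (vector [Z d 1 \<omega>, Z d 2 \<omega>, Z d 3 \<omega>]))"
    \<comment> \<open>The elements of the type \<open>3\<close> are \<open>1\<close>, \<open>2\<close> and \<open>3 = 0\<close>; this matches them with the labels of the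
        prototypes.\<close>
    define ix :: "3 \<Rightarrow> nat" where "ix i = (if i = 1 then 1 else if i = 2 then 2 else 3)" for i
    have ix: "ix i \<in> {1..3}" for i by (simp add: ix_def)
    have ix_inj: "ix i = ix j \<longleftrightarrow> i = j" for i j
      using exhaust_3[of i] exhaust_3[of j] by (auto simp: ix_def)
    \<comment> \<open>Only the direction of the query is random given the prototypes, and it is uniform.\<close>
    have cond: "AE \<omega> in M d. ?E d \<omega> = (\<integral>v. f (projections d (\<lambda>i. Uc d (ix i) \<omega>) v) \<partial>unif_sphere d)"
      if d: "d \<ge> 1" for d
    proof -
      interpret prob_space "M d" using prob_M d by simp
      let ?B = "\<Pi>\<^sub>M i\<in>{1..3::nat}. borel \<Otimes>\<^sub>M borel_vec d"
      let ?Y = "\<lambda>\<omega>. \<lambda>i\<in>{1..3}. (Rc d i \<omega>, Uc d i \<omega>)"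
      let ?h = "\<lambda>(v, y). f (projections d (\<lambda>i. snd (y (ix i))) v)"
      have "indep_var (Pi\<^sub>M {0} (\<lambda>_. borel \<Otimes>\<^sub>M borel_vec d)) (\<lambda>\<omega>. \<lambda>l\<in>{0}. (Rc d l \<omega>, Uc d l \<omega>)) ?B ?Y"
        by (rule indep_var_restrict[OF copies_indep[OF d]]) auto
      then have "distr (M d) (borel_vec d) (\<lambda>\<omega>. snd ((\<lambda>l\<in>{0}. (Rc d l \<omega>, Uc d l \<omega>)) 0)) \<Otimes>\<^sub>M distr (M d) ?B ?Y
          = distr (M d) (borel_vec d \<Otimes>\<^sub>M ?B) (\<lambda>\<omega>. (snd ((\<lambda>l\<in>{0}. (Rc d l \<omega>, Uc d l \<omega>)) 0), ?Y \<omega>))"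
      proof (rule indep_var_compose_joint_law)
        show "(\<lambda>x. snd (x 0)) \<in> measurable (Pi\<^sub>M {0} (\<lambda>_. borel \<Otimes>\<^sub>M borel_vec d)) (borel_vec d)"
          by measurable
      qed (rule measurable_ident_sets[OF refl])
      then have joint: "distr (M d) (borel_vec d) (Uc d 0) \<Otimes>\<^sub>M distr (M d) ?B ?Y
          = distr (M d) (borel_vec d \<Otimes>\<^sub>M ?B) (\<lambda>\<omega>. (Uc d 0 \<omega>, ?Y \<omega>))"
        unfolding restrict_apply' [OF singletonI] snd_conv .
      have Y_rv: "?Y \<in> measurable (M d) ?B"
        using pair_rv[OF d] by (intro measurable_restrict) auto
      have h_meas: "?h \<in> borel_measurable (borel_vec d \<Otimes>\<^sub>M ?B)"
      proof -
        have [measurable]: "(\<lambda>y. snd (y (ix i))) \<in> measurable ?B (borel_vec d)" for i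
          using ix[of i] by measurable
        show ?thesis unfolding projections_def by measurable
      qed
      have "AE \<omega> in M d. real_cond_exp (M d) (vimage_algebra (space (M d)) ?Y ?B) (\<lambda>\<omega>. ?h (Uc d 0 \<omega>, ?Y \<omega>)) \<omega>
          = (\<integral>v. ?h (v, ?Y \<omega>) \<partial>distr (M d) (borel_vec d) (Uc d 0))"
        by (rule real_cond_exp_indep[OF U_rv[OF d] Y_rv joint h_meas, where C = C]) (auto simp: C)
      moreover have "?h (Uc d 0 \<omega>, ?Y \<omega>) = f (vector [Z d 1 \<omega>, Z d 2 \<omega>, Z d 3 \<omega>])" for \<omega>
        by (auto simp: projections_def vector_3_eq Z_def ix_def intro!: arg_cong[where f = f] simp: vec_eq_iff)
      moreover have "?h (v, ?Y \<omega>) = f (projections d (\<lambda>i. Uc d (ix i) \<omega>) v)" for v \<omega>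
        using ix by simp
      ultimately show ?thesis
        using U_law[OF d, of 0] unfolding generated_by_def by simp
    qed
    \<comment> \<open>Outside an event of probability \<open>O(1/d)\<close> the Gram matrix of the prototypes is within \<open>\<eta>\<close> of
        the identity, and there the uniform central limit theorem applies. The bound involves no
        truncation level, hence the coefficient 0.\<close>
    show "conv_in_prob M ?E ?c"
    proof (rule conv_in_probI_tail_bound[where a = 0])
      fix \<delta> K :: real assume \<delta>: "0 < \<delta>"
      obtain \<eta> d0 where \<eta>: "0 < \<eta>" and d0: "1 \<le> d0"
        and close: "\<And>d (u :: 3 \<Rightarrow> nat \<Rightarrow> real). d0 \<le> d \<Longrightarrow>
          \<forall>i j. \<bar>inner_vec d (u i) (u j) - (if i = j then 1 else 0)\<bar> \<le> \<eta> \<Longrightarrow>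
          \<bar>(\<integral>v. f (projections d u v) \<partial>unif_sphere d) - ?c\<bar> < \<delta>"
        using projections_clt_uniform[OF f \<delta>] by blast
      show "\<exists>b. \<forall>\<^sub>F d in sequentially. measure (M d) {\<omega> \<in> space (M d). \<delta> < \<bar>?E d \<omega> - ?c\<bar>} \<le> 0 / K\<^sup>2 + b / real d"
      proof (intro exI eventually_sequentiallyI)
        fix d assume dd: "d0 \<le> d"
        then have d: "d \<ge> 1" using d0 by simp
        interpret prob_space "M d" using prob_M d by simp
        \<comment> \<open>The pairs whose inner product must be small; the diagonal of the Gram matrix is exactly 1.\<close>
        let ?P = "{(i, j). i \<in> {1..3::nat} \<and> j \<in> {1..3} \<and> i \<noteq> j}"
        let ?A = "\<lambda>p. {\<omega> \<in> space (M d). sqrt (real d) * \<eta> < \<bar>sqrt (real d) * inner_vec d (Uc d (fst p) \<omega>) (Uc d (snd p) \<omega>)\<bar>}"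
        have fin: "finite ?P" by (rule finite_subset[of _ "{1..3} \<times> {1..3}"]) auto
        have A_sets: "?A p \<in> sets (M d)" if "p \<in> ?P" for p
        proof -
          have [measurable]: "Uc d (fst p) \<in> measurable (M d) (borel_vec d)" "Uc d (snd p) \<in> measurable (M d) (borel_vec d)"
            using that d by (auto intro!: U_rv)
          show ?thesis by measurable
        qed
        have "measure (M d) {\<omega> \<in> space (M d). \<delta> < \<bar>?E d \<omega> - ?c\<bar>} \<le> measure (M d) (\<Union>p\<in>?P. ?A p)"
        proof (rule finite_measure_mono_AE)
          show "AE \<omega> in M d. \<omega> \<in> {\<omega> \<in> space (M d). \<delta> < \<bar>?E d \<omega> - ?c\<bar>} \<longrightarrow> \<omega> \<in> (\<Union>p\<in>?P. ?A p)"
            using cond[OF d] U_norm[OF d]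
          proof eventually_elim
            case (elim \<omega>)
            show ?case
            proof (intro impI, rule ccontr)
              assume \<omega>: "\<omega> \<in> {\<omega> \<in> space (M d). \<delta> < \<bar>?E d \<omega> - ?c\<bar>}" and not: "\<omega> \<notin> (\<Union>p\<in>?P. ?A p)"
              have "\<bar>inner_vec d (Uc d (ix i) \<omega>) (Uc d (ix j) \<omega>) - (if i = j then 1 else 0)\<bar> \<le> \<eta>" for i j
              proof (cases "i = j")
                case True
                have "L2_set (Uc d (ix j) \<omega>) {..<d} = 1" using elim ix[of j] by auto
                then have "inner_vec d (Uc d (ix j) \<omega>) (Uc d (ix j) \<omega>) = 1"
                  by (simp add: L2_set_def power2_eq_square)
                then show ?thesis using True \<eta> by simp
              next
                case False
                then have "(ix i, ix j) \<in> ?P" using ix ix_inj by auto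
                then have "\<omega> \<notin> ?A (ix i, ix j)" using not by blast
                then have "\<not> sqrt (real d) * \<eta> < \<bar>sqrt (real d) * inner_vec d (Uc d (ix i) \<omega>) (Uc d (ix j) \<omega>)\<bar>"
                  using \<omega> by simp
                then show ?thesis using False d by (simp add: abs_mult)
              qed
              then have "\<bar>(\<integral>v. f (projections d (\<lambda>i. Uc d (ix i) \<omega>) v) \<partial>unif_sphere d) - ?c\<bar> < \<delta>"
                by (intro close dd) auto
              then show False using \<omega> elim by simp
            qed
          qed
          show "(\<Union>p\<in>?P. ?A p) \<in> sets (M d)" by (intro sets.finite_UN fin A_sets)
        qed
        also have "\<dots> \<le> (\<Sum>p\<in>?P. measure (M d) (?A p))"
          by (intro finite_measure_subadditive_finite fin image_subsetI A_sets)
        also have "\<dots> \<le> (\<Sum>p\<in>?P. 4 / (sqrt (real d) * \<eta>)\<^sup>2 + 4 / real d)"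
          using d \<eta> by (intro sum_mono inner_tail) auto
        also have "\<dots> = 0 / K\<^sup>2 + real (card ?P) * (4 / \<eta>\<^sup>2 + 4) / real d"
          using d \<eta> by (simp add: power_mult_distrib field_simps)
        finally show "measure (M d) {\<omega> \<in> space (M d). \<delta> < \<bar>?E d \<omega> - ?c\<bar>}
          \<le> 0 / K\<^sup>2 + real (card ?P) * (4 / \<eta>\<^sup>2 + 4) / real d" .
      qed
    qed simp
  qed

  \<comment> \<open>The size of the remainder when \<open>\<xi>\<close> and \<open>Z\<close> are truncated at level \<open>K\<close>. Every term has a factor
      \<open>\<tau>\<close>, and the first also a factor \<open>\<lambda>\<close>; this is why the remainder vanishes when \<open>\<lambda>\<close> is bounded and
      is \<open>o(\<lambda>)\<close> when \<open>\<lambda>\<close> diverges.\<close>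
  define rb where "rb d K = \<bar>lam d\<bar> * \<bar>tau d\<bar> * K\<^sup>2 / 2 + (2 * \<bar>tau d\<bar> * K + (tau d)\<^sup>2 * K\<^sup>2) * K" for d K
  have r_bound: "\<bar>r d i \<omega>\<bar> \<le> rb d K"
    if "\<bar>xic d 0 \<omega>\<bar> \<le> K" "\<bar>xic d i \<omega>\<bar> \<le> K" "\<bar>Z d i \<omega>\<bar> \<le> K" for d i \<omega> K
  proof -
    have K: "0 \<le> K" using that(1) by linarith
    have "\<bar>lam d * tau d * (xic d i \<omega>)\<^sup>2 / 2\<bar> = \<bar>lam d\<bar> * \<bar>tau d\<bar> * \<bar>xic d i \<omega>\<bar>\<^sup>2 / 2"
      by (simp add: abs_mult)
    also have "\<dots> \<le> \<bar>lam d\<bar> * \<bar>tau d\<bar> * K\<^sup>2 / 2"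
      using that by (intro divide_right_mono mult_left_mono power_mono) auto
    finally have 1: "\<bar>lam d * tau d * (xic d i \<omega>)\<^sup>2 / 2\<bar> \<le> \<bar>lam d\<bar> * \<bar>tau d\<bar> * K\<^sup>2 / 2" .
    have a: "\<bar>tau d * xic d 0 \<omega>\<bar> \<le> \<bar>tau d\<bar> * K" "\<bar>tau d * xic d i \<omega>\<bar> \<le> \<bar>tau d\<bar> * K"
      using that by (auto simp: abs_mult intro!: mult_left_mono)
    have "\<bar>xic d 0 \<omega>\<bar> * \<bar>xic d i \<omega>\<bar> \<le> K * K"
      using that K by (intro mult_mono) auto
    then have b: "\<bar>(tau d)\<^sup>2 * xic d 0 \<omega> * xic d i \<omega>\<bar> \<le> (tau d)\<^sup>2 * K\<^sup>2"
      by (simp add: abs_mult mult.assoc power2_eq_square[of K] mult_left_mono)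
    have "\<bar>tau d * xic d 0 \<omega> + tau d * xic d i \<omega> + (tau d)\<^sup>2 * xic d 0 \<omega> * xic d i \<omega>\<bar>
        \<le> 2 * \<bar>tau d\<bar> * K + (tau d)\<^sup>2 * K\<^sup>2"
      using a b by linarith
    then have 2: "\<bar>tau d * xic d 0 \<omega> + tau d * xic d i \<omega> + (tau d)\<^sup>2 * xic d 0 \<omega> * xic d i \<omega>\<bar> * \<bar>Z d i \<omega>\<bar>
        \<le> (2 * \<bar>tau d\<bar> * K + (tau d)\<^sup>2 * K\<^sup>2) * K"
      using that(3) K by (intro mult_mono) simp_all
    have "\<bar>r d i \<omega>\<bar> \<le> \<bar>lam d * tau d * (xic d i \<omega>)\<^sup>2 / 2\<bar>
        + \<bar>tau d * xic d 0 \<omega> + tau d * xic d i \<omega> + (tau d)\<^sup>2 * xic d 0 \<omega> * xic d i \<omega>\<bar> * \<bar>Z d i \<omega>\<bar>"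
      unfolding r_def abs_mult[of _ "Z d i \<omega>", symmetric] by (rule abs_triangle_ineq4)
    then show ?thesis unfolding rb_def using 1 2 by linarith
  qed
  \<comment> \<open>Both regimes at once, with a normalising factor \<open>a\<close>. The constants are \<open>16 = 4 * 1 + 3 * 4\<close> and
      \<open>12 = 3 * 4\<close>: four radii \<open>\<xi>\<close> with tail \<open>1 / K\<^sup>2\<close>, three projections \<open>Z\<close> with tail \<open>4 / K\<^sup>2 + 4 / d\<close>.\<close>
  have remainder: "conv_in_prob M (\<lambda>d \<omega>. a d * (MAX i\<in>{1..3}. \<bar>r d i \<omega>\<bar>)) 0"
    if a: "\<And>d. d \<ge> 1 \<Longrightarrow> 0 \<le> a d" and lim: "\<And>K. (\<lambda>d. a d * rb d K) \<longlonglongrightarrow> 0" for a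
  proof (rule conv_in_probI_tail_bound[where a = 16])
    fix \<delta> K :: real assume \<delta>: "0 < \<delta>" and K: "0 < K"
    show "\<exists>b. \<forall>\<^sub>F d in sequentially.
        measure (M d) {\<omega> \<in> space (M d). \<delta> < \<bar>a d * (MAX i\<in>{1..3}. \<bar>r d i \<omega>\<bar>) - 0\<bar>} \<le> 16 / K\<^sup>2 + b / real d"
    proof (rule exI)
      show "\<forall>\<^sub>F d in sequentially.
        measure (M d) {\<omega> \<in> space (M d). \<delta> < \<bar>a d * (MAX i\<in>{1..3}. \<bar>r d i \<omega>\<bar>) - 0\<bar>} \<le> 16 / K\<^sup>2 + 12 / real d"
        using order_tendstoD(2)[OF lim[of K] \<delta>] eventually_ge_at_top[of 1]
      proof eventually_elim
        case (elim d)
        then have d: "d \<ge> 1" by simp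
        interpret prob_space "M d" using prob_M d by simp
        let ?A = "\<lambda>i. {\<omega> \<in> space (M d). K < \<bar>xic d i \<omega>\<bar>}"
        let ?B = "\<lambda>i. {\<omega> \<in> space (M d). K < \<bar>Z d i \<omega>\<bar>}"
        have A_sets: "?A i \<in> sets (M d)" if "i \<in> {0..3}" for i
          using xic_rv[OF d that] by measurable
        have B_sets: "?B i \<in> sets (M d)" if "i \<in> {0..3}" for i
          using Z_rv[OF d that] by measurable
        have UA: "(\<Union>i\<in>{0..3}. ?A i) \<in> sets (M d)" and UB: "(\<Union>i\<in>{1..3}. ?B i) \<in> sets (M d)"
          using A_sets B_sets by (auto intro!: sets.finite_UN)
        have "measure (M d) {\<omega> \<in> space (M d). \<delta> < \<bar>a d * (MAX i\<in>{1..3}. \<bar>r d i \<omega>\<bar>) - 0\<bar>}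
            \<le> measure (M d) ((\<Union>i\<in>{0..3}. ?A i) \<union> (\<Union>i\<in>{1..3}. ?B i))"
        proof (rule finite_measure_mono)
          show "{\<omega> \<in> space (M d). \<delta> < \<bar>a d * (MAX i\<in>{1..3}. \<bar>r d i \<omega>\<bar>) - 0\<bar>} \<subseteq> (\<Union>i\<in>{0..3}. ?A i) \<union> (\<Union>i\<in>{1..3}. ?B i)"
          proof (rule subsetI, rule ccontr)
            fix \<omega>
            assume \<omega>: "\<omega> \<in> {\<omega> \<in> space (M d). \<delta> < \<bar>a d * (MAX i\<in>{1..3}. \<bar>r d i \<omega>\<bar>) - 0\<bar>}"
              and not: "\<omega> \<notin> (\<Union>i\<in>{0..3}. ?A i) \<union> (\<Union>i\<in>{1..3}. ?B i)"
            have xs: "\<bar>xic d i \<omega>\<bar> \<le> K" if "i \<in> {0..3}" for i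
              using not \<omega> that by force
            have zs: "\<bar>Z d i \<omega>\<bar> \<le> K" if "i \<in> {1..3}" for i
              using not \<omega> that by force
            have "(MAX i\<in>{1..3}. \<bar>r d i \<omega>\<bar>) \<le> rb d K"
              using xs zs by (subst Max_le_iff) (auto intro!: r_bound)
            then have "a d * (MAX i\<in>{1..3}. \<bar>r d i \<omega>\<bar>) \<le> a d * rb d K"
              using a[OF d] by (rule mult_left_mono)
            moreover have "0 \<le> (MAX i\<in>{1..3}. \<bar>r d i \<omega>\<bar>)"
              by (subst Max_ge_iff) auto
            then have "0 \<le> a d * (MAX i\<in>{1..3}. \<bar>r d i \<omega>\<bar>)"
              using a[OF d] by simp
            ultimately show False using \<omega> elim by simp
          qed
        qed (use UA UB in blast)
        also have "\<dots> \<le> measure (M d) (\<Union>i\<in>{0..3}. ?A i) + measure (M d) (\<Union>i\<in>{1..3}. ?B i)"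
          using UA UB by (rule measure_Un_le)
        also have "\<dots> \<le> (\<Sum>i\<in>{0..3}. measure (M d) (?A i)) + (\<Sum>i\<in>{1..3}. measure (M d) (?B i))"
          by (intro add_mono finite_measure_subadditive_finite finite_atLeastAtMost image_subsetI)
            (simp_all add: A_sets B_sets)
        also have "\<dots> \<le> (\<Sum>i\<in>{0..3::nat}. 1 / K\<^sup>2) + (\<Sum>i\<in>{1..3::nat}. 4 / K\<^sup>2 + 4 / real d)"
          using d K inner_tail[OF d, of 0 _ K] by (intro add_mono sum_mono xi_tail) (auto simp: Z_def)
        also have "\<dots> = 16 / K\<^sup>2 + 12 / real d"
          by simp
        finally show ?case .
      qed
    qed
  qed simp
  have tau_abs: "(\<lambda>d. \<bar>tau d\<bar>) \<longlonglongrightarrow> 0"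
    using tau_lim by (rule tendsto_rabs_zero)
  have small: "(\<lambda>d. (2 * \<bar>tau d\<bar> * K + (tau d)\<^sup>2 * K\<^sup>2) * K) \<longlonglongrightarrow> 0" for K
  proof -
    have "(\<lambda>d. (2 * \<bar>tau d\<bar> * K + (tau d)\<^sup>2 * K\<^sup>2) * K) \<longlonglongrightarrow> (2 * 0 * K + 0\<^sup>2 * K\<^sup>2) * K"
      by (intro tendsto_intros tau_abs tau_lim)
    then show ?thesis by simp
  qed
  have bounded_case: "conv_in_prob M (\<lambda>d \<omega>. MAX i\<in>{1..3}. \<bar>r d i \<omega>\<bar>) 0" if lamO: "lam \<in> O(\<lambda>_. 1)"
  proof -
    obtain c where c: "\<forall>\<^sub>F d in sequentially. \<bar>lam d\<bar> \<le> c"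
      using lamO by (auto elim!: landau_o.bigE)
    have "(\<lambda>d. \<bar>lam d\<bar> * \<bar>tau d\<bar> * K\<^sup>2 / 2) \<longlonglongrightarrow> 0" for K
    proof (rule Lim_null_comparison)
      show "\<forall>\<^sub>F d in sequentially. norm (\<bar>lam d\<bar> * \<bar>tau d\<bar> * K\<^sup>2 / 2) \<le> c * \<bar>tau d\<bar> * K\<^sup>2 / 2"
        using c by eventually_elim (auto simp: abs_mult intro!: mult_right_mono)
      have "(\<lambda>d. c * \<bar>tau d\<bar> * K\<^sup>2 / 2) \<longlonglongrightarrow> c * 0 * K\<^sup>2 / 2"
        by (intro tendsto_intros tau_abs) simp
      then show "(\<lambda>d. c * \<bar>tau d\<bar> * K\<^sup>2 / 2) \<longlonglongrightarrow> 0" by simp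
    qed
    then have "(\<lambda>d. 1 * rb d K) \<longlonglongrightarrow> 0" for K
      unfolding rb_def using tendsto_add[OF _ small[of K]] by fastforce
    then have "conv_in_prob M (\<lambda>d \<omega>. 1 * (MAX i\<in>{1..3}. \<bar>r d i \<omega>\<bar>)) 0"
      by (intro remainder[of "\<lambda>_. 1"]) auto
    then show ?thesis by simp
  qed
  have divergent_case: "conv_in_prob M (\<lambda>d \<omega>. 1 / lam d * (MAX i\<in>{1..3}. \<bar>r d i \<omega>\<bar>)) 0"
    if lamT: "filterlim lam at_top sequentially"
  proof (rule remainder)
    show "0 \<le> 1 / lam d" if "d \<ge> 1" for d using lam_pos[OF that] by simp
    fix K
    have inv: "(\<lambda>d. 1 / lam d) \<longlonglongrightarrow> 0"
      using tendsto_inverse_0_at_top[OF lamT] by (simp add: inverse_eq_divide)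
    have "(\<lambda>d. \<bar>tau d\<bar> * K\<^sup>2 / 2 + 1 / lam d * ((2 * \<bar>tau d\<bar> * K + (tau d)\<^sup>2 * K\<^sup>2) * K)) \<longlonglongrightarrow> 0 * K\<^sup>2 / 2 + 0 * 0"
      by (intro tendsto_add tendsto_mult tendsto_divide tendsto_const tau_abs inv small) simp
    then have "(\<lambda>d. \<bar>tau d\<bar> * K\<^sup>2 / 2 + 1 / lam d * ((2 * \<bar>tau d\<bar> * K + (tau d)\<^sup>2 * K\<^sup>2) * K)) \<longlonglongrightarrow> 0"
      by simp
    moreover have "\<forall>\<^sub>F d in sequentially. \<bar>tau d\<bar> * K\<^sup>2 / 2 + 1 / lam d * ((2 * \<bar>tau d\<bar> * K + (tau d)\<^sup>2 * K\<^sup>2) * K)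
        = 1 / lam d * rb d K"
      using eventually_ge_at_top[of 1]
    proof eventually_elim
      case (elim d)
      then show ?case using lam_pos[of d] unfolding rb_def by (simp add: distrib_left)
    qed
    ultimately show "(\<lambda>d. 1 / lam d * rb d K) \<longlonglongrightarrow> 0"
      by (rule Lim_transform_eventually)
  qed
  show ?thesis
    using r_rv ordering clt bounded_case divergent_case by (intro exI[of _ r]) blast
qed

end
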